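(* Let $d>15$ be an integer and let $T$ be the (trilinear) pyramid averaging operator on $\mathbb{R}^d$, $$T(f,g,h)(x)=\int_{M}f(x-u)\,g(x-v)\,h(x-w)\,d\mu(u,v,w),\qquad f,g,h\in\mathcal{S}(\mathbb{R}^d),$$ where $\mu$ is the surface measure on $M=\{(u,v,w)\in(\mathbb{S}^{d-1})^3: |u-v|=|v-w|=|w-u|=1\}$. Let $p_0=\frac{5d}{3d-2}$ and $$S=\{(0,1,0),(1,0,0),(0,0,1),(1/2,1/2,1/2),(1/p_0,1/p_0,0),(1/p_0,0,1/p_0),(0,1/p_0,1/p_0)\}.$$ Then for all $(1/p,1/q,1/s)\in Conv(S)$, with $r$ defined by $1/r=1/p+1/q+1/s$, the operator $T$ is bounded from $L^p(\mathbb{R}^d)\times L^q(\mathbb{R}^d)\times L^s(\mathbb{R}^d)$ to $L^r(\mathbb{R}^d)$; that is, there is a constant $C$ (depending on $d,p,q,s$) such that $$\|T(f,g,h)\|_{L^r}\le C\|f\|_{L^p}\|g\|_{L^q}\|h\|_{L^s}\quad\text{for all } f,g,h\in\mathcal{S}(\mathbb{R}^d).$$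
   Context: $\mathcal{S}(\mathbb{R}^d)$ is the space of Schwartz functions, $\mathbb{S}^{d-1}$ is the unit sphere in $\mathbb{R}^d$, and $|\cdot|$ is the Euclidean norm. $Conv(S)$ denotes the interior (in $\mathbb{R}^3$) of the convex hull of the finite set of points $S$. The exponent $r$ may be less than $1$, in which case $\|F\|_{L^r}=(\int|F|^r)^{1/r}$ is the usual quasi-norm. The set $M$ consists of the triples $(u,v,w)$ such that $\{0,u,v,w\}$ are the vertices of a regular tetrahedron of side length $1$. Integration against $\mu$ is identified (with normalization) with integration over $SO(d)$ with respect to the Haar probability measure $dR$: $$\int_M F\,d\mu=\int_{SO(d)}F\Big(Re_1,\;R\big(\tfrac12e_1+\tfrac{\sqrt3}{2}e_2\big),\;R\big(\tfrac12e_1+\tfrac{1}{2\sqrt3}e_2+\tfrac{\sqrt2}{\sqrt3}e_3\big)\Big)\,dR,$$ where $e_1,e_2,e_3,\dots$ is the standard basis of $\mathbb{R}^d$. *)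

theory Defs
  imports "HOL-Probability.Probability"
begin

definition partial_deriv ::
    "'n \<Rightarrow> (real ^ 'n \<Rightarrow> complex) \<Rightarrow> real ^ 'n::finite \<Rightarrow> complex" where
  "partial_deriv i f x = frechet_derivative f (at x) (axis i 1)"

fun iter_partial_deriv ::
    "'n list \<Rightarrow> (real ^ 'n \<Rightarrow> complex) \<Rightarrow> real ^ 'n::finite \<Rightarrow> complex" where
  "iter_partial_deriv [] f = f"
| "iter_partial_deriv (i # is) f = partial_deriv i (iter_partial_deriv is f)"

text \<open>Multi-indices are represented by lists of coordinate directions. Differentiability of all
  iterated partial derivatives says that the function is smooth.\<close>

definition schwartz :: "(real ^ 'n::finite \<Rightarrow> complex) set" where
  "schwartz = {f. \<forall>is. (\<forall>x. iter_partial_deriv is f differentiable (at x)) \<and>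
     (\<forall>k::nat. bounded (range (\<lambda>x. norm x ^ k *\<^sub>R iter_partial_deriv is f x)))}"

text \<open>The exponent is any positive real (a quasi-norm below 1). The value is an extended
  nonnegative real, so that a function outside \<open>L\<^sup>p\<close> has norm \<open>\<infinity>\<close>.\<close>

definition Lp_norm :: "real \<Rightarrow> (real ^ 'n::finite \<Rightarrow> complex) \<Rightarrow> ennreal" where
  "Lp_norm p f =
     (let I = (\<integral>\<^sup>+ x. ennreal (norm (f x) powr p) \<partial>lborel)
      in if I = \<infinity> then \<infinity> else ennreal (enn2real I powr (1 / p)))"

definition SO :: "(real ^ 'n ^ 'n::finite) set" where
  "SO = {R. rotation_matrix R}"

definition haar_prob_SO :: "(real ^ 'n ^ 'n::finite) measure \<Rightarrow> bool" where
  "haar_prob_SO H \<longleftrightarrow>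
     prob_space H \<and> sets H = sets (restrict_space borel SO) \<and>
     (\<forall>R\<in>SO. \<forall>A\<in>sets H. emeasure H ((\<lambda>Q. R ** Q) ` A) = emeasure H A)"

definition pyramid_set :: "((real ^ 'n) \<times> (real ^ 'n) \<times> (real ^ 'n::finite)) set" where
  "pyramid_set = {(u, v, w). u \<in> sphere 0 1 \<and> v \<in> sphere 0 1 \<and> w \<in> sphere 0 1 \<and>
     norm (u - v) = 1 \<and> norm (v - w) = 1 \<and> norm (w - u) = 1}"

text \<open>\<open>b\<close> numbers the coordinates, so that \<open>axis (b 1) 1\<close>, \<open>axis (b 2) 1\<close>, ... are the standard
  basis vectors \<open>e\<^sub>1\<close>, \<open>e\<^sub>2\<close>, ...\<close>

definition rotated_pyramid ::
    "(nat \<Rightarrow> 'n) \<Rightarrow> real ^ 'n ^ 'n \<Rightarrow> (real ^ 'n) \<times> (real ^ 'n) \<times> (real ^ 'n::finite)" where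
  "rotated_pyramid b R =
     (let e = (\<lambda>k. axis (b k) 1) in
       (R *v e 1,
        R *v ((1 / 2) *\<^sub>R e 1 + (sqrt 3 / 2) *\<^sub>R e 2),
        R *v ((1 / 2) *\<^sub>R e 1 + (1 / (2 * sqrt 3)) *\<^sub>R e 2 + (sqrt 2 / sqrt 3) *\<^sub>R e 3)))"

text \<open>The normalized surface measure on the set of pyramids, as the image of the Haar measure.\<close>

definition pyramid_measure ::
    "(real ^ 'n ^ 'n) measure \<Rightarrow> (nat \<Rightarrow> 'n) \<Rightarrow>
     ((real ^ 'n) \<times> (real ^ 'n) \<times> (real ^ 'n::finite)) measure" where
  "pyramid_measure H b = distr H (restrict_space borel pyramid_set) (rotated_pyramid b)"

definition pyramid_op ::
    "(real ^ 'n ^ 'n) measure \<Rightarrow> (nat \<Rightarrow> 'n) \<Rightarrow>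
     (real ^ 'n \<Rightarrow> complex) \<Rightarrow> (real ^ 'n \<Rightarrow> complex) \<Rightarrow> (real ^ 'n \<Rightarrow> complex) \<Rightarrow>
     real ^ 'n::finite \<Rightarrow> complex" where
  "pyramid_op H b f g h x =
     (\<integral>(u, v, w). f (x - u) * g (x - v) * h (x - w) \<partial>(pyramid_measure H b))"

definition boundedness_vertices :: "real \<Rightarrow> (real \<times> real \<times> real) set" where
  "boundedness_vertices d = (let p0 = 5 * d / (3 * d - 2) in
     {(0, 1, 0), (1, 0, 0), (0, 0, 1), (1/2, 1/2, 1/2),
      (1/p0, 1/p0, 0), (1/p0, 0, 1/p0), (0, 1/p0, 1/p0)})"

definition Conv :: "(real \<times> real \<times> real) set \<Rightarrow> (real \<times> real \<times> real) set" where
  "Conv A = interior (convex hull A)"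

lemma rotated_pyramid_in_pyramid_set:
  fixes b :: "nat \<Rightarrow> 'n::finite"
  assumes b: "inj_on b {1, 2, 3}" and R: "R \<in> SO"
  shows "rotated_pyramid b R \<in> pyramid_set"
proof -
  have orth: "orthogonal_transformation ((*v) R)"
    using R by (simp add: SO_def rotation_matrix_def orthogonal_transformation_matrix)
  have nrm: "norm (R *v x) = norm x" for x
    using orth by (simp add: orthogonal_transformation)
  have ne: "b 1 \<noteq> b 2" "b 1 \<noteq> b 3" "b 2 \<noteq> b 3"
    using inj_onD[OF b, of 1 2] inj_onD[OF b, of 1 3] inj_onD[OF b, of 2 3] by auto
  define e1 e2 e3 :: "real ^ 'n" where "e1 = axis (b 1) 1" "e2 = axis (b 2) 1" "e3 = axis (b 3) 1"
  note e_defs = this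
  have ip: "e1 \<bullet> e1 = 1" "e2 \<bullet> e2 = 1" "e3 \<bullet> e3 = 1"
    "e1 \<bullet> e2 = 0" "e1 \<bullet> e3 = 0" "e2 \<bullet> e3 = 0"
    "e2 \<bullet> e1 = 0" "e3 \<bullet> e1 = 0" "e3 \<bullet> e2 = 0"
    using ne by (auto simp: e_defs inner_axis_axis)
  define \<alpha> \<beta> \<gamma> :: real where "\<alpha> = sqrt 3 / 2" "\<beta> = 1 / (2 * sqrt 3)" "\<gamma> = sqrt 2 / sqrt 3"
  note coeff_defs = this
  have c: "\<alpha> * \<alpha> = 3 / 4" "\<alpha> * \<beta> = 1 / 4" "\<beta> * \<beta> = 1 / 12" "\<gamma> * \<gamma> = 2 / 3"
    by (simp_all add: coeff_defs)
  define u v w where "u = e1" "v = (1 / 2) *\<^sub>R e1 + \<alpha> *\<^sub>R e2"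
    "w = (1 / 2) *\<^sub>R e1 + \<beta> *\<^sub>R e2 + \<gamma> *\<^sub>R e3"
  note uvw_defs = this
  have eq: "rotated_pyramid b R = (R *v u, R *v v, R *v w)"
    by (simp add: rotated_pyramid_def Let_def uvw_defs e_defs coeff_defs)
  have "norm u = 1" "norm v = 1" "norm w = 1"
    "norm (u - v) = 1" "norm (v - w) = 1" "norm (w - u) = 1"
    unfolding norm_eq_sqrt_inner uvw_defs
    by (simp_all add: inner_add_left inner_add_right inner_diff_left inner_diff_right ip
        algebra_simps c)
  then show ?thesis
    by (simp add: eq pyramid_set_def nrm matrix_vector_mult_diff_distrib[symmetric])
qed

lemma measurable_rotated_pyramid:
  fixes H :: "(real ^ 'n ^ 'n::finite) measure"
  assumes b: "inj_on b {1, 2, 3}" and H: "haar_prob_SO H"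
  shows "rotated_pyramid b \<in> H \<rightarrow>\<^sub>M restrict_space borel pyramid_set"
proof -
  have sp: "space H = SO"
    using H sets_eq_imp_space_eq[of H "restrict_space borel SO"]
    by (simp add: haar_prob_SO_def space_restrict_space)
  have lin: "bounded_linear (\<lambda>R::real ^ 'n ^ 'n. R *v x)" for x :: "real ^ 'n"
    by (intro linear_conv_bounded_linear[THEN iffD1] linearI)
      (simp_all add: matrix_vector_mult_add_rdistrib scaleR_matrix_vector_assoc)
  have "continuous_on UNIV (rotated_pyramid b :: real ^ 'n ^ 'n \<Rightarrow> _)"
    unfolding rotated_pyramid_def Let_def
    by (intro continuous_on_Pair linear_continuous_on lin)
  then have "rotated_pyramid b \<in> borel_measurable (borel :: (real ^ 'n ^ 'n) measure)"
    by (rule borel_measurable_continuous_onI)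
  then have "rotated_pyramid b \<in> borel_measurable (restrict_space borel (SO :: (real ^ 'n ^ 'n) set))"
    by (rule measurable_restrict_space1)
  then have "rotated_pyramid b \<in> borel_measurable H"
    using H by (simp add: haar_prob_SO_def cong: measurable_cong_sets)
  then show ?thesis
    using rotated_pyramid_in_pyramid_set[OF b] sp
    by (intro measurable_restrict_space2) auto
qed

lemma integral_pyramid_measure:
  fixes H :: "(real ^ 'n ^ 'n::finite) measure"
    and F :: "(real ^ 'n) \<times> (real ^ 'n) \<times> (real ^ 'n) \<Rightarrow> complex"
  assumes "inj_on b {1, 2, 3}" and "haar_prob_SO H"
    and "F \<in> borel_measurable (restrict_space borel pyramid_set)"
  shows "(\<integral>t. F t \<partial>pyramid_measure H b) = (\<integral>R. F (rotated_pyramid b R) \<partial>H)"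
  unfolding pyramid_measure_def
  using assms by (intro integral_distr measurable_rotated_pyramid)

end

theory Submission
  imports Defs
begin

text \<open>
  Since the operator is positive and local, it suffices to prove estimates with target \<open>L\<^sup>1\<close>: a
  function in \<open>L\<^sup>p\<close> is, up to a constant, a power \<open>F powr (1/p)\<close> of a function \<open>F \<ge> 0\<close> of integral
  at most 1. The triples of exponents for which
  \<open>\<integral>\<integral> F (t - R u) powr x * G (t - R v) powr y * H (t - R w) powr z dR dt\<close> is bounded for all such
  \<open>F, G, H\<close> form a convex set, by the weighted arithmetic-geometric mean inequality under the integral
  sign, so it is enough to treat a few vertices. Those come from a single fact: for independent
  uniform points on the sphere, their difference has a density at most \<open>C / norm z\<close> on the ball of
  radius 2. It gives the exponents \<open>(1/2, 3/4, 0)\<close> and, because the differences of the vertices of a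
  tetrahedron have length 1 (so that one stays away from the singularity), \<open>(1/2, 1/2, 1/2)\<close>.
\<close>

section \<open>Lebesgue measure and rotations\<close>

text \<open>The points \<open>R *v u\<close>, \<open>R *v v\<close>, \<open>R *v w\<close> come from
  one rotation and are not independent. The nontrivial estimates remove this dependence: translating
  by \<open>R *v u\<close> frees the first function,
  \<open>a * b \<le> a\<^sup>2 + b\<^sup>2\<close> splits it off, and for the exponents 1/2 the
  Cauchy-Schwarz inequality in \<open>R\<close> separates the other two. What remains is a product
  of two spherical averages, that is, an integral over two independent rotations, to which the
  density bound applies. The exponent 3/4 is the one that Young's convolution inequality allows for
  a kernel in L2, as 3/4 + 3/4 + 1/2 = 2, and \<open>1 / norm z\<close> on a ball is in L2 from
  dimension 3 on. Averaging (1/2, 3/4, 0) with its mirror image gives (5/8, 5/8, 0). As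
  \<open>1 / p0 = 3/5 - 2 / (5 * d)\<close>, the vertex (1/p0, 1/p0, 0) lies between this point and
  (1/2, 1/2, 0), the midpoint of two unit vectors. Target L1 suffices because the exponents in the
  hull add up to at least 1: then \<open>r \<le> 1\<close>, and on balls of fixed size Hoelder's
  inequality leads from L1 down to Lr.\<close>

lemma nn_integral_lborel_shift:
  fixes \<phi> :: "'a::euclidean_space \<Rightarrow> ennreal"
  assumes [measurable]: "\<phi> \<in> borel_measurable borel"
  shows "(\<integral>\<^sup>+x. \<phi> (c + x) \<partial>lborel) = (\<integral>\<^sup>+x. \<phi> x \<partial>lborel)"
proof -
  have "(\<integral>\<^sup>+x. \<phi> x \<partial>lborel) = (\<integral>\<^sup>+x. \<phi> x \<partial>distr lborel borel ((+) c))"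
    by (simp add: lborel_distr_plus)
  also have "\<dots> = (\<integral>\<^sup>+x. \<phi> (c + x) \<partial>lborel)"
    by (subst nn_integral_distr) auto
  finally show ?thesis by simp
qed

lemma lborel_Fubini:
  fixes f :: "'a::euclidean_space \<Rightarrow> 'b::euclidean_space \<Rightarrow> ennreal"
  assumes "case_prod f \<in> borel_measurable (lborel \<Otimes>\<^sub>M lborel)"
  shows "(\<integral>\<^sup>+x. \<integral>\<^sup>+y. f x y \<partial>lborel \<partial>lborel) = (\<integral>\<^sup>+y. \<integral>\<^sup>+x. f x y \<partial>lborel \<partial>lborel)"
  using lborel_pair.Fubini[OF assms] by simp

text \<open>Uniqueness of translation invariant measures, normalised on the unit ball, which an
  orthogonal map preserves.\<close>

lemma lborel_distr_orthogonal:
  fixes f :: "'a::euclidean_space \<Rightarrow> 'a"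
  assumes f: "orthogonal_transformation f"
  shows "distr lborel borel f = lborel"
proof (rule measure_eqI)
  fix A assume "A \<in> sets (distr lborel borel f)"
  then have A[measurable]: "A \<in> sets borel" by simp
  define B :: "'a set" where "B = ball 0 1"
  have B[measurable]: "B \<in> sets borel" by (simp add: B_def)
  have lin: "linear f" using f by (rule orthogonal_transformation_linear)
  have fm[measurable]: "f \<in> borel_measurable borel"
    using lin by (intro borel_measurable_continuous_onI linear_continuous_on linear_conv_bounded_linear[THEN iffD1])
  have nf: "norm (f x) = norm x" for x
    using f by (rule orthogonal_transformation_norm)
  have "surj f" using f by (rule orthogonal_transformation_surj)
  then have fg: "f (inv f y) = y" for y by (simp add: surj_f_inv_f)
  have 1: "(\<integral>\<^sup>+x. indicator A (f x + y) \<partial>lborel) = (\<integral>\<^sup>+x. indicator A (f x) \<partial>lborel)" for y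
    using nn_integral_lborel_shift[of "\<lambda>x. indicator A (f x)" "inv f y"]
    by (simp add: linear_add[OF lin] fg add.commute)
  have e: "emeasure (distr lborel borel f) A = (\<integral>\<^sup>+x. indicator A (f x) \<partial>lborel)"
    by (subst nn_integral_indicator[symmetric], simp, subst nn_integral_distr) auto
  \<comment> \<open>Translating by \<open>inv f y\<close> turns \<open>y - f x\<close> into
    \<open>- f x\<close>, which lies in the unit ball exactly if \<open>x\<close> does.\<close>
  have 2: "(\<integral>\<^sup>+x. indicator B (y - f x) \<partial>lborel) = emeasure lborel B" for y
  proof -
    have "(\<integral>\<^sup>+x. indicator B (y - f x) \<partial>lborel) = (\<integral>\<^sup>+x. indicator B (y - f (inv f y + x)) \<partial>lborel)"
      by (subst nn_integral_lborel_shift) auto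
    also have "\<dots> = (\<integral>\<^sup>+x. indicator B x \<partial>lborel)"
      by (intro nn_integral_cong) (simp add: linear_add[OF lin] fg B_def nf indicator_def)
    finally show ?thesis by simp
  qed
  \<comment> \<open>Both products measure the pairs with \<open>y \<in> B\<close> and
    \<open>f x + y \<in> A\<close>: integrating over \<open>x\<close> first, the shift by
    \<open>y\<close> has no effect; after the exchange it is moved onto \<open>B\<close>.\<close>
  have "emeasure lborel B * emeasure (distr lborel borel f) A =
      (\<integral>\<^sup>+y. indicator B y * (\<integral>\<^sup>+x. indicator A (f x + y) \<partial>lborel) \<partial>lborel)"
    unfolding 1 e by (subst nn_integral_multc) auto
  also have "\<dots> = (\<integral>\<^sup>+y. \<integral>\<^sup>+x. indicator B y * indicator A (f x + y) \<partial>lborel \<partial>lborel)"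
    by (subst nn_integral_cmult) auto
  also have "\<dots> = (\<integral>\<^sup>+x. \<integral>\<^sup>+y. indicator B y * indicator A (f x + y) \<partial>lborel \<partial>lborel)"
    by (subst lborel_Fubini) auto
  also have "\<dots> = (\<integral>\<^sup>+x. \<integral>\<^sup>+y. indicator B (y - f x) * indicator A y \<partial>lborel \<partial>lborel)"
    using nn_integral_lborel_shift[of "\<lambda>y. indicator B (y - f x) * indicator A y" "f x" for x]
    by (simp add: mult.commute)
  also have "\<dots> = (\<integral>\<^sup>+y. \<integral>\<^sup>+x. indicator B (y - f x) * indicator A y \<partial>lborel \<partial>lborel)"
    by (subst lborel_Fubini) auto
  also have "\<dots> = (\<integral>\<^sup>+y. emeasure lborel B * indicator A y \<partial>lborel)"
    by (subst nn_integral_multc) (auto simp: 2)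
  also have "\<dots> = emeasure lborel B * emeasure lborel A"
    by (simp add: nn_integral_cmult_indicator)
  finally have "emeasure lborel B * emeasure (distr lborel borel f) A = emeasure lborel B * emeasure lborel A" .
  moreover have "emeasure lborel B \<noteq> 0" "emeasure lborel B \<noteq> \<infinity>"
    using unit_ball_vol_pos[of "real DIM('a)"] by (auto simp: B_def emeasure_ball simp del: unit_ball_vol_pos)
  ultimately show "emeasure (distr lborel borel f) A = emeasure lborel A"
    by (simp add: ennreal_mult_cancel_left)
qed simp

lemma nn_integral_lborel_orthogonal:
  fixes f :: "'a::euclidean_space \<Rightarrow> 'a" and \<phi> :: "'a \<Rightarrow> ennreal"
  assumes f: "orthogonal_transformation f" and [measurable]: "\<phi> \<in> borel_measurable borel"
  shows "(\<integral>\<^sup>+x. \<phi> (f x) \<partial>lborel) = (\<integral>\<^sup>+x. \<phi> x \<partial>lborel)"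
proof -
  have fm[measurable]: "f \<in> borel_measurable borel"
    using orthogonal_transformation_linear[OF f]
    by (intro borel_measurable_continuous_onI linear_continuous_on linear_conv_bounded_linear[THEN iffD1])
  have "(\<integral>\<^sup>+x. \<phi> x \<partial>lborel) = (\<integral>\<^sup>+x. \<phi> x \<partial>distr lborel borel f)"
    by (simp add: lborel_distr_orthogonal[OF f])
  also have "\<dots> = (\<integral>\<^sup>+x. \<phi> (f x) \<partial>lborel)"
    by (subst nn_integral_distr) auto
  finally show ?thesis by simp
qed

lemma nn_integral_lborel_reflect:
  fixes \<phi> :: "'a::euclidean_space \<Rightarrow> ennreal"
  assumes [measurable]: "\<phi> \<in> borel_measurable borel"
  shows "(\<integral>\<^sup>+x. \<phi> (c - x) \<partial>lborel) = (\<integral>\<^sup>+x. \<phi> x \<partial>lborel)"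
proof -
  have "orthogonal_transformation (uminus :: 'a \<Rightarrow> 'a)"
    by (auto simp: orthogonal_transformation_def intro!: linearI)
  from nn_integral_lborel_orthogonal[OF this, of "\<lambda>x. \<phi> (c + x)"]
  show ?thesis by (simp add: nn_integral_lborel_shift)
qed

lemma norm_sq_eq_sum_Basis: "(norm z)\<^sup>2 = (\<Sum>b\<in>Basis. (z \<bullet> b)\<^sup>2)"
  unfolding power2_norm_eq_inner by (subst euclidean_inner) (simp add: power2_eq_square)

text \<open>The image of Lebesgue measure under \<open>norm\<close> and the measure with the stated
  density agree on all half-lines \<open>{..a}\<close>, by the volume of a ball and the fundamental
  theorem of calculus. They are finite there, and half-lines are an intersection-stable
  generator.\<close>

lemma nn_integral_norm_polar:
  fixes \<Phi> :: "real \<Rightarrow> ennreal"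
  assumes [measurable]: "\<Phi> \<in> borel_measurable borel"
  shows "(\<integral>\<^sup>+z. \<Phi> (norm (z::'a::euclidean_space)) \<partial>lborel) =
    (\<integral>\<^sup>+\<rho>. ennreal (DIM('a) * unit_ball_vol DIM('a) * \<rho> ^ (DIM('a) - 1)) * indicator {0..} \<rho> * \<Phi> \<rho> \<partial>lborel)"
proof -
  define w where "w \<rho> = ennreal (DIM('a) * unit_ball_vol DIM('a) * \<rho> ^ (DIM('a) - 1)) * indicator {0..} \<rho>" for \<rho> :: real
  have w[measurable]: "w \<in> borel_measurable borel" unfolding w_def by measurable
  have 1: "emeasure (distr lborel borel (norm :: 'a \<Rightarrow> real)) {..a} = emeasure (density lborel w) {..a}
      \<and> emeasure (distr lborel borel (norm :: 'a \<Rightarrow> real)) {..a} \<noteq> \<infinity>" for a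
  proof (cases "a \<ge> 0")
    case True
    have "emeasure (distr lborel borel (norm :: 'a \<Rightarrow> real)) {..a} = emeasure lborel (cball (0::'a) a)"
      by (subst emeasure_distr) (auto simp: vimage_def cball_def)
    also have "\<dots> = ennreal (unit_ball_vol DIM('a) * a ^ DIM('a))"
      using True by (rule emeasure_cball)
    finally have e1: "emeasure (distr lborel borel (norm :: 'a \<Rightarrow> real)) {..a} = \<dots>" .
    have "emeasure (density lborel w) {..a} =
      (\<integral>\<^sup>+\<rho>. ennreal (DIM('a) * unit_ball_vol DIM('a) * \<rho> ^ (DIM('a) - 1)) * indicator {0..a} \<rho> \<partial>lborel)"
      by (subst emeasure_density) (auto simp: w_def intro!: nn_integral_cong split: split_indicator)
    also have "\<dots> = ennreal (unit_ball_vol DIM('a) * a ^ DIM('a) - unit_ball_vol DIM('a) * 0 ^ DIM('a))"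
      by (intro nn_integral_FTC_Icc True)
        (auto intro!: derivative_eq_intros mult_nonneg_nonneg)
    finally show ?thesis using e1 by (simp add: zero_power)
  next
    case False
    then have "{x::'a. norm x \<le> a} = {}"
      by (auto dest: order_trans[OF norm_ge_zero])
    then have "emeasure (distr lborel borel (norm :: 'a \<Rightarrow> real)) {..a} = 0"
      by (subst emeasure_distr) (auto simp: vimage_def)
    moreover have z0: "w x * indicator {..a} x = 0" for x
      using False by (auto simp: w_def indicator_def)
    have "emeasure (density lborel w) {..a} = 0"
      by (subst emeasure_density) (simp_all add: z0 del: mult_eq_0_iff)
    ultimately show ?thesis by simp
  qed
  have "distr lborel borel (norm :: 'a \<Rightarrow> real) = density lborel w"
  proof (rule measure_eqI_generator_eq[where E="range (\<lambda>a. {..a})" and \<Omega>=UNIV and A="\<lambda>i. {..real i}"])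
    show "Int_stable (range (\<lambda>a::real. {..a}))"
      by (auto simp: Int_stable_def intro!: image_eqI)
    show "sets (distr lborel borel norm) = sigma_sets UNIV (range (\<lambda>a::real. {..a}))"
      by (simp add: borel_eq_atMost)
    then show "sets (density lborel w) = sigma_sets UNIV (range (\<lambda>a::real. {..a}))"
      by simp
    show "(\<Union>i. {..real i}) = UNIV"
      by (auto intro: real_arch_simple)
    show "emeasure (distr lborel borel (norm :: 'a \<Rightarrow> real)) {..real i} \<noteq> \<infinity>" for i
      using 1 by blast
    show "emeasure (distr lborel borel (norm :: 'a \<Rightarrow> real)) X = emeasure (density lborel w) X"
      if "X \<in> range (\<lambda>a. {..a})" for X
      using 1 that by blast
  qed auto
  then have "(\<integral>\<^sup>+z. \<Phi> z \<partial>distr lborel borel (norm :: 'a \<Rightarrow> real)) = (\<integral>\<^sup>+z. \<Phi> z \<partial>density lborel w)"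
    by simp
  then show ?thesis
    by (subst (asm) nn_integral_distr, simp, simp, subst (asm) nn_integral_density) (auto simp: w_def)
qed

section \<open>Spherical caps\<close>

text \<open>The set is a piece of the cylinder of radius \<open>t\<close> around the axis
  \<open>e\<close>. It fits into a box with half side 2 along \<open>e\<close> and half side
  \<open>t\<close> in every other direction.\<close>

lemma emeasure_tube_le:
  fixes e :: "'a::euclidean_space"
  assumes e: "e \<in> Basis" and t: "0 \<le> t"
  shows "emeasure lborel {z \<in> ball 0 2. (norm z)\<^sup>2 - (z \<bullet> e)\<^sup>2 \<le> t\<^sup>2} \<le> ennreal (4 * (2 * t) ^ (DIM('a) - 1))"
proof -
  define c where "c = (\<lambda>b. if b = e then 2 else t)"
  define u where "u = (\<Sum>b\<in>Basis. c b *\<^sub>R b)"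
  have ub: "u \<bullet> b = c b" if "b \<in> Basis" for b
    using that by (simp add: u_def)
  have c0: "c b \<ge> 0" for b using t by (simp add: c_def)
  have "{z \<in> ball 0 2. (norm z)\<^sup>2 - (z \<bullet> e)\<^sup>2 \<le> t\<^sup>2} \<subseteq> cbox (- u) u"
  proof clarify
    fix z :: 'a assume z: "z \<in> ball 0 2" "(norm z)\<^sup>2 - (z \<bullet> e)\<^sup>2 \<le> t\<^sup>2"
    have "\<bar>z \<bullet> b\<bar> \<le> c b" if b: "b \<in> Basis" for b
    proof (cases "b = e")
      case True
      then show ?thesis using Basis_le_norm[OF e, of z] z by (simp add: c_def)
    next
      case False
      have "(norm z)\<^sup>2 = (\<Sum>b\<in>Basis. (z \<bullet> b)\<^sup>2)"
        by (rule norm_sq_eq_sum_Basis)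
      also have "\<dots> \<ge> (\<Sum>b\<in>{e, b}. (z \<bullet> b)\<^sup>2)"
        using e b by (intro sum_mono2) auto
      finally have "(z \<bullet> b)\<^sup>2 \<le> t\<^sup>2" using z False by simp
      then have "\<bar>z \<bullet> b\<bar> \<le> t" using t by (metis power2_abs power2_le_imp_le)
      then show ?thesis using False by (simp add: c_def)
    qed
    then show "z \<in> cbox (- u) u"
      by (auto simp: mem_box ub abs_le_iff minus_le_iff)
  qed
  then have "emeasure lborel {z \<in> ball 0 2. (norm z)\<^sup>2 - (z \<bullet> e)\<^sup>2 \<le> t\<^sup>2} \<le> emeasure lborel (cbox (- u) u)"
    by (rule emeasure_mono) simp
  also have "\<dots> = ennreal (\<Prod>b\<in>Basis. (u - - u) \<bullet> b)"
    using c0 by (subst emeasure_lborel_cbox) (auto simp: ub intro: order_trans[of _ 0])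
  also have "(\<Prod>b\<in>Basis. (u - - u) \<bullet> b) = (\<Prod>b\<in>Basis. 2 * c b)"
    by (intro prod.cong) (auto simp: inner_simps ub)
  also have "\<dots> = 4 * (2 * t) ^ (DIM('a) - 1)"
    using e by (subst prod.remove[of _ e]) (auto simp: c_def)
  finally show ?thesis .
qed

text \<open>The integral over the ball is averaged over the segments \<open>z - s e\<close> with \<open>s \<in> [0, 1]\<close>. Along
  such a line \<open>\<rho> = norm (e - sgn (z - s *\<^sub>R e))\<close> has derivative \<open>\<rho> (1 - \<rho>\<^sup>2/4) / norm (z - s *\<^sub>R e)\<close>,
  and the distance of the line to the origin is at most \<open>\<rho> sqrt (1 - \<rho>\<^sup>2/4)\<close>.\<close>

lemma nn_integral_cap_le:
  fixes e :: "'a::euclidean_space" and \<Phi> :: "real \<Rightarrow> ennreal"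
  assumes e: "e \<in> Basis" and n: "3 \<le> DIM('a)" and [measurable]: "\<Phi> \<in> borel_measurable borel"
  shows "(\<integral>\<^sup>+z. indicator (ball 0 1) z * \<Phi> (norm (e - sgn z)) \<partial>lborel)
    \<le> (\<integral>\<^sup>+\<rho>. ennreal (2 ^ (DIM('a) + 1) * \<rho> ^ (DIM('a) - 2)) * indicator {0..2} \<rho> * \<Phi> \<rho> \<partial>lborel)"
proof -
  define m2 where "m2 z = (norm z)\<^sup>2 - (z \<bullet> e)\<^sup>2" for z
  \<comment> \<open>If \<theta> is the angle between \<open>e\<close> and a vector, the chord
    between their directions is \<rho> = 2 sin (\<theta>/2), and \<open>w \<rho>\<close> is the
    square of sin \<theta>. Hence \<open>m2\<close>, the squared distance to the axis, is the
    squared length times \<open>w \<rho>\<close>.\<close>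
  define w where "w \<rho> = \<rho>\<^sup>2 * (1 - \<rho>\<^sup>2/4)" for \<rho> :: real
  define X where "X z = indicator (ball 0 1) z * \<Phi> (norm (e - sgn z))" for z
  \<comment> \<open>The weight is the reciprocal of the derivative of \<rho> along the line, taken
    at distance 1 from the origin.\<close>
  define A where "A \<rho> = indicator {0<..<2} \<rho> * ennreal (1 / (\<rho> * (1 - \<rho>\<^sup>2/4))) * \<Phi> \<rho>" for \<rho>
  define k where "k z \<rho> = A \<rho> * indicator {z \<in> ball 0 2. m2 z \<le> w \<rho>} z" for z \<rho>
  have m2m[measurable]: "m2 \<in> borel_measurable borel" unfolding m2_def by measurable
  have wm[measurable]: "w \<in> borel_measurable borel" unfolding w_def by measurable
  have ball_m[measurable]: "ball (0::'a) c \<in> sets borel" for c by simp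
  have sgnm[measurable]: "sgn \<in> borel_measurable (borel :: 'a measure)"
    unfolding sgn_div_norm by measurable
  have Xm[measurable]: "X \<in> borel_measurable borel" unfolding X_def by measurable
  have Am[measurable]: "A \<in> borel_measurable borel" unfolding A_def by measurable
  have km[measurable]: "case_prod k \<in> borel_measurable (borel \<Otimes>\<^sub>M borel)"
    unfolding k_def indicator_def mem_Collect_eq by measurable
  have ee: "e \<bullet> e = 1" "norm e = 1" using e by auto
  \<comment> \<open>\<open>m2 z > 0\<close> keeps the line away from the origin, so that
    \<open>r\<close> and \<open>g\<close> below are positive and differentiable.\<close>
  have line: "(\<integral>\<^sup>+s. indicator {0..1} s * X (z - s *\<^sub>R e) \<partial>lborel) \<le> (\<integral>\<^sup>+\<rho>. k z \<rho> \<partial>lborel)"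
    if m: "m2 z > 0" for z
  proof (cases "z \<in> ball 0 2")
    case False
    have "z - s *\<^sub>R e \<notin> ball 0 1" if "s \<in> {0..1}" for s
    proof -
      have "norm z \<le> norm (z - s *\<^sub>R e) + norm (s *\<^sub>R e)"
        using norm_triangle_ineq[of "z - s *\<^sub>R e" "s *\<^sub>R e"] by simp
      also have "norm (s *\<^sub>R e) \<le> 1" using that by (simp add: ee)
      finally show ?thesis using False by simp
    qed
    then have "(\<integral>\<^sup>+s. indicator {0..1} s * X (z - s *\<^sub>R e) \<partial>lborel) = (\<integral>\<^sup>+s. 0 \<partial>(lborel::real measure))"
      by (intro nn_integral_cong) (auto simp: X_def split: split_indicator)
    then show ?thesis by simp
  next
    case z2: True
    define y where "y s = z \<bullet> e - s" for s
    define r where "r s = sqrt (m2 z + (y s)\<^sup>2)" for s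
    define g where "g s = sqrt (2 - 2 * (y s / r s))" for s
    define g' where "g' s = m2 z / (r s ^ 3 * g s)" for s
    have r2: "(r s)\<^sup>2 = m2 z + (y s)\<^sup>2" for s using m by (simp add: r_def)
    have r0: "r s > 0" for s using m by (auto simp: r_def intro!: add_pos_nonneg)
    have yr: "\<bar>y s\<bar> < r s" for s
    proof -
      have "(y s)\<^sup>2 < (r s)\<^sup>2" using m by (simp add: r2)
      then show ?thesis using r0[of s] by (metis power2_abs power2_less_imp_less less_imp_le)
    qed
    have yr1: "y s / r s < 1" "- 1 < y s / r s" for s
      using yr[of s] r0[of s] by (auto simp: abs_less_iff pos_divide_less_eq pos_less_divide_eq)
    have g2: "(g s)\<^sup>2 = 2 - 2 * (y s / r s)" for s
      using yr1[of s] by (simp add: g_def)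
    have g0: "g s > 0" for s using yr1[of s] by (simp add: g_def)
    have g4: "g s < 2" for s
    proof -
      have "(g s)\<^sup>2 < 2\<^sup>2" using yr1[of s] unfolding g2 by simp
      then show ?thesis by (rule power2_less_imp_less) simp
    qed
    have wg: "m2 z = (r s)\<^sup>2 * w (g s)" for s
    proof -
      have "(2 - 2 * a) * (1 - (2 - 2 * a) / 4) = 1 - a\<^sup>2" for a :: real
        by (simp add: power2_eq_square field_simps)
      then have "w (g s) = 1 - (y s / r s)\<^sup>2" unfolding w_def g2 .
      then have "(r s)\<^sup>2 * w (g s) = (r s)\<^sup>2 - (y s)\<^sup>2"
        using r0[of s] by (simp only: power_divide right_diff_distrib) simp
      then show ?thesis using r2[of s] by linarith
    qed
    have cancel: "1 / (b * c) * (a\<^sup>2 * (b\<^sup>2 * c) / (a ^ 3 * b)) = 1 / a" if "a > 0" "b > 0" "c > 0" for a b c :: real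
      using that by (simp add: power2_eq_square power3_eq_cube)
    have ring: "a - u * t - u * t + u * (u * 1) = a - t\<^sup>2 + (t - u)\<^sup>2" for a t u :: real
      by (simp add: power2_eq_square algebra_simps)
    have rnorm: "norm (z - s *\<^sub>R e) = r s" for s
    proof -
      have sc: "(u *\<^sub>R e) \<bullet> v = u * (e \<bullet> v)" "v \<bullet> (u *\<^sub>R e) = u * (v \<bullet> e)" for u v by simp_all
      have "(norm (z - s *\<^sub>R e))\<^sup>2 = (z - s *\<^sub>R e) \<bullet> (z - s *\<^sub>R e)"
        by (rule power2_norm_eq_inner)
      also have "\<dots> = z \<bullet> z - s * (z \<bullet> e) - (s * (e \<bullet> z) - s * (s * (e \<bullet> e)))"
        by (simp only: inner_diff_left inner_diff_right sc right_diff_distrib)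
      also have "\<dots> = (norm z)\<^sup>2 - s * (z \<bullet> e) - s * (z \<bullet> e) + s * (s * 1)"
        unfolding power2_norm_eq_inner[of z] inner_commute[of e z] ee(1) by simp
      also have "\<dots> = (r s)\<^sup>2"
        unfolding r2 m2_def y_def by (rule ring)
      finally have "(norm (z - s *\<^sub>R e))\<^sup>2 = (r s)\<^sup>2" .
      then show ?thesis by (rule power2_eq_imp_eq[OF _ norm_ge_zero less_imp_le[OF r0]])
    qed
    have gnorm: "norm (e - sgn (z - s *\<^sub>R e)) = g s" for s
    proof -
      define v where "v = z - s *\<^sub>R e"
      have v: "norm v = r s" "v \<bullet> e = y s"
        unfolding v_def using rnorm[of s] by (auto simp: y_def inner_diff_left ee)
      have vv: "v \<bullet> v = (r s)\<^sup>2" using power2_norm_eq_inner[of v] unfolding v(1) by (rule sym)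
      have "(norm (e - sgn v))\<^sup>2 = e \<bullet> e - inverse (norm v) * (v \<bullet> e) - (inverse (norm v) * (v \<bullet> e) -
          inverse (norm v) * (inverse (norm v) * (v \<bullet> v)))"
        unfolding power2_norm_eq_inner sgn_div_norm inner_diff_left inner_diff_right inner_scaleR_left
          inner_scaleR_right inner_commute[of e v] by (simp only: right_diff_distrib)
      also have "\<dots> = (g s)\<^sup>2"
        unfolding g2 v vv ee using r0[of s] by (simp add: power2_eq_square field_simps)
      finally have "(norm (e - sgn v))\<^sup>2 = (g s)\<^sup>2" .
      then show ?thesis unfolding v_def by (rule power2_eq_imp_eq[OF _ norm_ge_zero less_imp_le[OF g0]])
    qed
    have dy: "(y has_real_derivative -1) (at s)" for s
      unfolding y_def by (auto intro!: derivative_eq_intros)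
    have dr: "(r has_real_derivative - y s / r s) (at s)" for s
    proof -
      have "((\<lambda>s. m2 z + (y s)\<^sup>2) has_real_derivative - 2 * y s) (at s)"
        using DERIV_add[OF DERIV_const DERIV_power[OF dy, of 2]] by simp
      moreover have "m2 z + (y s)\<^sup>2 > 0" using m by (simp add: add_pos_nonneg)
      ultimately have "((\<lambda>s. sqrt (m2 z + (y s)\<^sup>2)) has_real_derivative
          inverse (sqrt (m2 z + (y s)\<^sup>2)) / 2 * (- 2 * y s)) (at s)"
        by (intro DERIV_chain'[OF _ DERIV_real_sqrt])
      then show ?thesis
        unfolding r_def by (rule DERIV_cong) (simp add: field_simps)
    qed
    have dg: "(g has_real_derivative g' s) (at s)" for s
    proof -
      have "((\<lambda>s. 2 - 2 * (y s / r s)) has_real_derivative 2 * m2 z / r s ^ 3) (at s)"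
      proof (rule DERIV_cong)
        show "((\<lambda>s. 2 - 2 * (y s / r s)) has_real_derivative
            0 - 2 * (((-1) * r s - y s * (- y s / r s)) / (r s * r s))) (at s)"
          using r0[of s] by (intro derivative_intros DERIV_cmult dy dr) auto
        have "2 * (((-1) * r s - y s * (- y s / r s)) / (r s * r s)) = - 2 * ((r s)\<^sup>2 - (y s)\<^sup>2) / r s ^ 3"
          using r0[of s] by (simp add: field_simps power2_eq_square power3_eq_cube)
        then show "0 - 2 * (((-1) * r s - y s * (- y s / r s)) / (r s * r s)) = 2 * m2 z / r s ^ 3"
          by (simp add: r2)
      qed
      then have "((\<lambda>s. sqrt (2 - 2 * (y s / r s))) has_real_derivative
          inverse (sqrt (2 - 2 * (y s / r s))) / 2 * (2 * m2 z / r s ^ 3)) (at s)"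
        by (rule DERIV_chain'[OF _ DERIV_real_sqrt]) (use yr1[of s] in linarith)
      then show ?thesis
        unfolding g'_def g_def by (rule DERIV_cong) (simp add: field_simps)
    qed
    have cr: "continuous_on {0..1} r" using dr by (intro continuous_at_imp_continuous_on ballI DERIV_isCont)
    have cg: "continuous_on {0..1} g" using dg by (intro continuous_at_imp_continuous_on ballI DERIV_isCont)
    have cg': "continuous_on {0..1} g'"
      unfolding g'_def using r0 g0 by (intro continuous_intros cr cg) (simp add: r0[THEN less_imp_neq, THEN not_sym] g0[THEN less_imp_neq, THEN not_sym])
    have g'0: "g' s \<ge> 0" for s using r0[of s] g0[of s] m by (simp add: g'_def)
    have kz[measurable]: "k z \<in> borel_measurable borel"
      unfolding k_def indicator_def mem_Collect_eq by measurable
    have "(\<integral>\<^sup>+s. indicator {0..1} s * X (z - s *\<^sub>R e) \<partial>lborel)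
      \<le> (\<integral>\<^sup>+s. k z (g s) * g' s * indicator {0..1} s \<partial>lborel)"
    proof (intro nn_integral_mono)
      fix s :: real
      show "indicator {0..1} s * X (z - s *\<^sub>R e) \<le> k z (g s) * g' s * indicator {0..1} s"
      proof (cases "s \<in> {0..1} \<and> z - s *\<^sub>R e \<in> ball 0 1")
        case True
        then have r1: "r s < 1" using rnorm[of s] by simp
        have w0: "w (g s) \<ge> 0" using g0[of s] g4[of s] power_mono[of "g s" 2 2] by (simp add: w_def)
        have "(r s)\<^sup>2 \<le> 1" using r1 r0[of s] by (simp add: power_le_one)
        then have mw: "m2 z \<le> w (g s)" using wg[of s] w0 mult_right_mono[of "(r s)\<^sup>2" 1 "w (g s)"] by simp
        have q: "1 - (g s)\<^sup>2/4 > 0" using g0[of s] g4[of s] power_strict_mono[of "g s" 2 2] by simp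
        \<comment> \<open>Inside the unit ball the weight of \<open>A\<close> times the Jacobian
          \<open>g' s\<close> is at least 1. Inserting it only enlarges the integrand and makes it
          ready for the substitution of \<open>g s\<close> by \<rho>.\<close>
        have "1 / (g s * (1 - (g s)\<^sup>2/4)) * g' s = 1 / r s"
          unfolding g'_def wg[of s] w_def by (rule cancel[OF r0 g0 q])
        also have "\<dots> \<ge> 1" using r1 r0[of s] by simp
        finally have ge1: "1 \<le> ennreal (1 / (g s * (1 - (g s)\<^sup>2/4))) * ennreal (g' s)"
          using q g0[of s] by (subst ennreal_mult[symmetric]) (auto simp: g'0)
        have "indicator {0..1} s * X (z - s *\<^sub>R e) = \<Phi> (g s) * 1"
          using True by (simp add: X_def gnorm)
        also have "\<dots> \<le> \<Phi> (g s) * (ennreal (1 / (g s * (1 - (g s)\<^sup>2/4))) * ennreal (g' s))"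
          by (intro mult_left_mono ge1) simp
        also have "\<dots> = k z (g s) * g' s * indicator {0..1} s"
          using True mw z2 g0[of s] g4[of s] by (simp add: k_def A_def mult_ac)
        finally show ?thesis .
      qed (auto simp: X_def split: split_indicator)
    qed
    also have "\<dots> = (\<integral>\<^sup>+\<rho>. k z \<rho> * indicator {g 0..g 1} \<rho> \<partial>lborel)"
      by (intro nn_integral_substitution_aux[symmetric] kz dg cg' g'0) auto
    also have "\<dots> \<le> (\<integral>\<^sup>+\<rho>. k z \<rho> \<partial>lborel)"
      by (intro nn_integral_mono) (auto split: split_indicator)
    finally show ?thesis .
  qed
  \<comment> \<open>The exceptional axis lies in the hyperplane orthogonal to a second basis vector,
    a null set.\<close>
  have AEm: "AE z in lborel. m2 z > 0"
  proof -
    have "card (Basis - {e}) \<noteq> 0" using e n by simp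
    then obtain b where b: "b \<in> Basis" "b \<noteq> e" by (metis card.empty Diff_iff ex_in_conv insertI1)
    have "AE z in lborel. z \<bullet> b \<noteq> 0" using b by (intro AE_lborel_inner_neq)
    then show ?thesis
    proof eventually_elim
      case (elim z)
      have "(norm z)\<^sup>2 = (\<Sum>b\<in>Basis. (z \<bullet> b)\<^sup>2)"
        by (rule norm_sq_eq_sum_Basis)
      also have "\<dots> \<ge> (\<Sum>b\<in>{e, b}. (z \<bullet> b)\<^sup>2)"
        using e b by (intro sum_mono2) auto
      finally have "(z \<bullet> e)\<^sup>2 + (z \<bullet> b)\<^sup>2 \<le> (norm z)\<^sup>2" using b by simp
      moreover have "(z \<bullet> b)\<^sup>2 > 0" using elim by simp
      ultimately show ?case unfolding m2_def by linarith
    qed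
  qed
  have "(\<integral>\<^sup>+z. X z \<partial>lborel) = (\<integral>\<^sup>+s. indicator {0..1} s * (\<integral>\<^sup>+z. X z \<partial>lborel) \<partial>(lborel :: real measure))"
    by (subst nn_integral_multc) auto
  also have "\<dots> = (\<integral>\<^sup>+s. \<integral>\<^sup>+z. indicator {0..1} s * X (z - s *\<^sub>R e) \<partial>lborel \<partial>lborel)"
    using nn_integral_lborel_shift[OF Xm, of "- s *\<^sub>R e" for s]
    by (simp add: nn_integral_cmult)
  also have "\<dots> = (\<integral>\<^sup>+z. \<integral>\<^sup>+s. indicator {0..1} s * X (z - s *\<^sub>R e) \<partial>lborel \<partial>lborel)"
    by (rule lborel_Fubini) measurable
  also have "\<dots> \<le> (\<integral>\<^sup>+z. \<integral>\<^sup>+\<rho>. k z \<rho> \<partial>lborel \<partial>lborel)"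
    using AEm by (intro nn_integral_mono_AE) (auto elim!: eventually_mono intro: line)
  also have "\<dots> = (\<integral>\<^sup>+\<rho>. \<integral>\<^sup>+z. k z \<rho> \<partial>lborel \<partial>lborel)"
    by (rule lborel_Fubini) measurable
  also have "\<dots> \<le> (\<integral>\<^sup>+\<rho>. ennreal (2 ^ (DIM('a) + 1) * \<rho> ^ (DIM('a) - 2)) * indicator {0..2} \<rho> * \<Phi> \<rho> \<partial>lborel)"
  proof (intro nn_integral_mono)
    fix \<rho> :: real
    have "(\<integral>\<^sup>+z. k z \<rho> \<partial>lborel) = A \<rho> * emeasure lborel {z \<in> ball 0 2. m2 z \<le> w \<rho>}"
      unfolding k_def by (subst nn_integral_cmult_indicator) auto
    also have "\<dots> \<le> ennreal (2 ^ (DIM('a) + 1) * \<rho> ^ (DIM('a) - 2)) * indicator {0..2} \<rho> * \<Phi> \<rho>"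
    proof (cases "0 < \<rho> \<and> \<rho> < 2")
      case True
      have q: "1 - \<rho>\<^sup>2/4 > 0" "1 - \<rho>\<^sup>2/4 \<le> 1" using True power_strict_mono[of \<rho> 2 2] by auto
      define t where "t = sqrt (w \<rho>)"
      have t: "t\<^sup>2 = w \<rho>" "t \<ge> 0" using q True by (simp_all add: t_def w_def)
      have "t\<^sup>2 \<le> \<rho>\<^sup>2" unfolding t(1) w_def using q by (intro mult_left_le) auto
      then have t\<rho>: "t \<le> \<rho>" using True by (rule power2_le_imp_le[OF _ less_imp_le[OF conjunct1]])
      \<comment> \<open>Of the \<open>l + 2\<close> factors \<open>t\<close> in the tube bound, two
        combine to \<open>w \<rho>\<close>, which cancels the singular weight and leaves one factor
        \<rho>. The other \<open>l\<close> are at most \<rho> each, which gives the exponent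
        \<open>DIM('a) - 2\<close>.\<close>
      define l where "l = DIM('a) - 3"
      have l: "DIM('a) = l + 3" using n by (simp add: l_def)
      have n1: "DIM('a) - 1 = l + 2" and n2: "DIM('a) + 1 = l + 4" and n3: "DIM('a) - 2 = l + 1"
        using l by simp_all
      have cancel: "1 / (x * y) * (4 * (a * (b * (x\<^sup>2 * y)))) = 4 * a * (b * x)" if "x > 0" "y > 0" for x y a b :: real
        using that by (simp add: power2_eq_square)
      have "(2 * t) ^ (DIM('a) - 1) = 2 ^ (l + 2) * (t ^ l * w \<rho>)"
        unfolding t(1)[symmetric] n1 power_mult_distrib power_add[of t] ..
      also have "1 / (\<rho> * (1 - \<rho>\<^sup>2/4)) * (4 * \<dots>) = 4 * 2 ^ (l + 2) * (t ^ l * \<rho>)"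
        unfolding w_def by (rule cancel) (use True q in auto)
      also have "\<dots> = 2 ^ (l + 4) * (t ^ l * \<rho>)" by (simp add: power_add)
      also have "\<dots> \<le> 2 ^ (l + 4) * (\<rho> ^ l * \<rho>)"
        using t t\<rho> True by (intro mult_left_mono mult_right_mono power_mono) auto
      also have "\<dots> = 2 ^ (DIM('a) + 1) * \<rho> ^ (DIM('a) - 2)"
        unfolding n2 n3 by (simp only: power_add power_one_right)
      finally have le: "1 / (\<rho> * (1 - \<rho>\<^sup>2/4)) * (4 * (2 * t) ^ (DIM('a) - 1)) \<le> 2 ^ (DIM('a) + 1) * \<rho> ^ (DIM('a) - 2)" .
      have "A \<rho> * emeasure lborel {z \<in> ball 0 2. m2 z \<le> w \<rho>} \<le>
          (ennreal (1 / (\<rho> * (1 - \<rho>\<^sup>2/4))) * \<Phi> \<rho>) * ennreal (4 * (2 * t) ^ (DIM('a) - 1))"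
        using emeasure_tube_le[OF e t(2)] True unfolding t m2_def
        by (intro mult_mono) (auto simp: A_def)
      also have "\<dots> = ennreal (1 / (\<rho> * (1 - \<rho>\<^sup>2/4)) * (4 * (2 * t) ^ (DIM('a) - 1))) * \<Phi> \<rho>"
        using True q t by (subst ennreal_mult) (auto simp: mult_ac)
      also have "\<dots> \<le> ennreal (2 ^ (DIM('a) + 1) * \<rho> ^ (DIM('a) - 2)) * \<Phi> \<rho>"
        using le by (intro mult_right_mono ennreal_leI) auto
      finally show ?thesis using True by simp
    qed (auto simp: A_def)
    finally show "(\<integral>\<^sup>+z. k z \<rho> \<partial>lborel) \<le> ennreal (2 ^ (DIM('a) + 1) * \<rho> ^ (DIM('a) - 2)) * indicator {0..2} \<rho> * \<Phi> \<rho>" .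
  qed
  finally show ?thesis unfolding X_def .
qed

section \<open>Averages over rotations\<close>

lemma borel_measurable_matrix_vector_mult [measurable (raw)]:
  fixes f :: "'a \<Rightarrow> real ^ 'n::finite ^ 'm::finite" and g :: "'a \<Rightarrow> real ^ 'n"
  assumes "f \<in> borel_measurable N" and "g \<in> borel_measurable N"
  shows "(\<lambda>x. f x *v g x) \<in> borel_measurable N"
  by (rule borel_measurable_continuous_Pair[OF assms])
    (simp add: matrix_vector_mult_def, intro continuous_intros)

lemma borel_measurable_transpose [measurable (raw)]:
  fixes f :: "'a \<Rightarrow> real ^ 'n::finite ^ 'm::finite"
  assumes "f \<in> borel_measurable N"
  shows "(\<lambda>x. transpose (f x)) \<in> borel_measurable N"
proof -
  have "transpose \<in> borel_measurable (borel :: (real ^ 'n ^ 'm) measure)"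
    by (rule borel_measurable_continuous_onI) (simp add: transpose_def, intro continuous_intros)
  from measurable_compose[OF assms this] show ?thesis .
qed

lemma rotation_matrix_transpose: "rotation_matrix Q \<Longrightarrow> rotation_matrix (transpose Q)"
  by (simp add: rotation_matrix_def det_transpose orthogonal_matrix_transpose)

lemma rotation_matrix_orthogonal_transformation:
  "rotation_matrix Q \<Longrightarrow> orthogonal_transformation ((*v) Q)" for Q :: "real ^ 'n::finite ^ 'n"
  by (simp add: rotation_matrix_def orthogonal_transformation_matrix)

lemma rotation_matrix_norm: "rotation_matrix Q \<Longrightarrow> norm (Q *v x) = norm x" for Q :: "real ^ 'n::finite ^ 'n"
  using rotation_matrix_orthogonal_transformation orthogonal_transformation_norm by blast

lemma rotation_matrix_sgn: "rotation_matrix Q \<Longrightarrow> sgn (Q *v x) = Q *v sgn x" for Q :: "real ^ 'n::finite ^ 'n"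
  by (simp add: sgn_div_norm rotation_matrix_norm matrix_vector_mult_scaleR)

text \<open>Up to a constant this bounds the density of the difference of two independent uniform
  points of the unit sphere. Such points are at most 2 apart, hence the cut-off. At the origin the
  value is 0, as \<open>1 / 0 = 0\<close>.\<close>

definition inv_kernel :: "'a::real_normed_vector \<Rightarrow> ennreal" where
  "inv_kernel z = ennreal (1 / norm z) * indicator (cball 0 2) z"

lemma borel_measurable_inv_kernel [measurable]:
  "inv_kernel \<in> borel_measurable (borel :: 'a::euclidean_space measure)"
proof -
  have [measurable]: "cball 0 2 \<in> sets (borel :: 'a measure)" by simp
  show ?thesis unfolding inv_kernel_def by measurable
qed

text \<open>In polar coordinates the weight \<open>\<rho> ^ (DIM('a) - 1)\<close> absorbs the two
  poles \<open>1 / \<rho>\<close> once the dimension is at least 3, and a bounded integrand on the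
  interval from 0 to 2 remains.\<close>

lemma nn_integral_inv_kernel_square:
  assumes n: "3 \<le> DIM('a::euclidean_space)"
  obtains c :: real where "c \<ge> 0" and "(\<integral>\<^sup>+z. inv_kernel z * inv_kernel (z::'a) \<partial>lborel) \<le> ennreal c"
proof -
  define w where "w = DIM('a) * unit_ball_vol DIM('a)"
  have w0: "w \<ge> 0" by (simp add: w_def)
  have "(\<integral>\<^sup>+z. inv_kernel z * inv_kernel (z::'a) \<partial>lborel) =
    (\<integral>\<^sup>+z. (\<lambda>\<rho>. ennreal (1 / \<rho> * (1 / \<rho>)) * indicator {0..2} \<rho>) (norm (z::'a)) \<partial>lborel)"
    by (intro nn_integral_cong) (auto simp: inv_kernel_def ennreal_mult'[symmetric] split: split_indicator)
  also have "\<dots> = (\<integral>\<^sup>+\<rho>. ennreal (w * \<rho> ^ (DIM('a) - 1)) * indicator {0..} \<rho> *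
      (ennreal (1 / \<rho> * (1 / \<rho>)) * indicator {0..2} \<rho>) \<partial>lborel)"
    unfolding w_def by (rule nn_integral_norm_polar) measurable
  also have "\<dots> \<le> (\<integral>\<^sup>+\<rho>. ennreal (w * 2 ^ (DIM('a) - 3)) * indicator {0..2} \<rho> \<partial>(lborel :: real measure))"
  proof (intro nn_integral_mono)
    fix \<rho> :: real
    show "ennreal (w * \<rho> ^ (DIM('a) - 1)) * indicator {0..} \<rho> *
      (ennreal (1 / \<rho> * (1 / \<rho>)) * indicator {0..2} \<rho>) \<le> ennreal (w * 2 ^ (DIM('a) - 3)) * indicator {0..2} \<rho>"
    proof (cases "0 < \<rho> \<and> \<rho> \<le> 2")
      case True
      have n1: "DIM('a) - 1 = (DIM('a) - 3) + 2" using n by simp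
      have "w * \<rho> ^ (DIM('a) - 1) * (1 / \<rho> * (1 / \<rho>)) = w * \<rho> ^ (DIM('a) - 3)"
        using True unfolding n1 power_add by (simp add: power2_eq_square)
      also have "\<dots> \<le> w * 2 ^ (DIM('a) - 3)"
        using True w0 by (intro mult_left_mono power_mono) auto
      finally have "ennreal (w * \<rho> ^ (DIM('a) - 1)) * ennreal (1 / \<rho> * (1 / \<rho>)) \<le> ennreal (w * 2 ^ (DIM('a) - 3))"
        using True w0 by (subst ennreal_mult[symmetric]) (auto intro: ennreal_leI)
      then show ?thesis using True by simp
    next
      case False
      then show ?thesis by (cases "\<rho> = 0") (auto split: split_indicator)
    qed
  qed
  also have "\<dots> = ennreal (w * 2 ^ (DIM('a) - 3) * 2)"
    using w0 by (subst nn_integral_cmult_indicator) (auto simp: ennreal_mult')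
  finally show ?thesis using w0 by (intro that[of "w * 2 ^ (DIM('a) - 3) * 2"]) simp_all
qed

text \<open>The Haar measure is viewed as a Borel measure on all matrices that gives the rotations
  full measure. Measurability is then that of Borel functions, and the group enters only through
  \<open>AE_rotation\<close> and the invariance of integrals.\<close>

locale rotation_average =
  fixes M :: "(real ^ 'n::finite ^ 'n) measure"
  assumes sets_M [measurable_cong, simp]: "sets M = sets borel"
    and prob_space_M: "prob_space M"
    and AE_rotation: "AE R in M. rotation_matrix R"
    and left_invariant: "\<lbrakk>rotation_matrix Q; \<phi> \<in> borel_measurable borel\<rbrakk> \<Longrightarrow>
      (\<integral>\<^sup>+R. \<phi> (Q ** R) \<partial>M) = (\<integral>\<^sup>+R. \<phi> R \<partial>M)"
    and card3: "3 \<le> CARD('n)"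
begin

sublocale prob_space M by (rule prob_space_M)

declare emeasure_space_1 [simp]

lemma Fubini_lborel:
  fixes f :: "real ^ 'n ^ 'n \<Rightarrow> 'b::euclidean_space \<Rightarrow> ennreal"
  assumes "case_prod f \<in> borel_measurable (M \<Otimes>\<^sub>M lborel)"
  shows "(\<integral>\<^sup>+R. \<integral>\<^sup>+y. f R y \<partial>lborel \<partial>M) = (\<integral>\<^sup>+y. \<integral>\<^sup>+R. f R y \<partial>M \<partial>lborel)"
proof -
  interpret P: pair_sigma_finite M "lborel :: 'b measure" ..
  show ?thesis using P.Fubini[OF assms] by simp
qed

lemma Fubini_M:
  assumes "case_prod f \<in> borel_measurable (M \<Otimes>\<^sub>M M)"
  shows "(\<integral>\<^sup>+R. \<integral>\<^sup>+Q. f R Q \<partial>M \<partial>M) = (\<integral>\<^sup>+Q. \<integral>\<^sup>+R. f R Q \<partial>M \<partial>M)"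
proof -
  interpret P: pair_sigma_finite M M ..
  show ?thesis using P.Fubini[OF assms] by simp
qed

text \<open>Right invariance on vectors, from left invariance alone: insert an average over \<open>transpose Q\<close>
  and exchange the two integrals.\<close>

lemma average_radial:
  fixes y y' :: "real ^ 'n"
  assumes eq: "norm y = norm y'" and [measurable]: "\<phi> \<in> borel_measurable borel"
  shows "(\<integral>\<^sup>+R. \<phi> (R *v y) \<partial>M) = (\<integral>\<^sup>+R. \<phi> (R *v y') \<partial>M)"
proof -
  define \<xi> where "\<xi> z = (\<integral>\<^sup>+Q. \<phi> (transpose Q *v z) \<partial>M)" for z
  have \<xi>: "\<xi> (P *v z) = \<xi> z" if P: "rotation_matrix P" for P z
  proof -
    \<comment> \<open>Transposition turns left multiplication of \<open>Q\<close> into right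
      multiplication, where it acts on \<open>z\<close>.\<close>
    have "\<xi> (P *v z) = (\<integral>\<^sup>+Q. \<phi> (transpose (transpose P ** Q) *v z) \<partial>M)"
      unfolding \<xi>_def by (simp add: matrix_transpose_mul matrix_vector_mul_assoc)
    also have "\<dots> = \<xi> z"
      unfolding \<xi>_def by (rule left_invariant[OF rotation_matrix_transpose[OF P]]) measurable
    finally show ?thesis .
  qed
  have avg: "(\<integral>\<^sup>+R. \<phi> (R *v z) \<partial>M) = \<xi> z" for z
  proof -
    have "(\<integral>\<^sup>+R. \<phi> (R *v z) \<partial>M) = (\<integral>\<^sup>+Q. \<integral>\<^sup>+R. \<phi> (R *v z) \<partial>M \<partial>M)" by simp
    also have "\<dots> = (\<integral>\<^sup>+Q. \<integral>\<^sup>+R. \<phi> (transpose Q *v (R *v z)) \<partial>M \<partial>M)"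
    proof (rule nn_integral_cong_AE, use AE_rotation in eventually_elim)
      case (elim Q)
      show ?case
        using left_invariant[OF rotation_matrix_transpose[OF elim], of "\<lambda>R. \<phi> (R *v z)"]
        by (simp add: matrix_vector_mul_assoc)
    qed
    also have "\<dots> = (\<integral>\<^sup>+R. \<xi> (R *v z) \<partial>M)"
      unfolding \<xi>_def by (rule Fubini_M) measurable
    also have "\<dots> = (\<integral>\<^sup>+R. \<xi> z \<partial>M)"
      by (rule nn_integral_cong_AE, use AE_rotation in eventually_elim) (rule \<xi>)
    finally show ?thesis by simp
  qed
  obtain f where f: "orthogonal_transformation f" "det (matrix f) = 1" "f y = y'"
    using rotation_exists[OF _ eq] card3 by auto
  then have "rotation_matrix (matrix f)" "matrix f *v y = y'"
    by (auto simp: rotation_matrix_def orthogonal_transformation_matrix orthogonal_transformation_linear)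
  then have "\<xi> y' = \<xi> y" using \<xi> by metis
  then show ?thesis by (simp add: avg)
qed

text \<open>The direction of a uniform point of the ball has the law of \<open>R *v a\<close>. The
  left side does not change when \<open>\<phi>\<close> is rotated, so it may be averaged over
  \<open>R\<close>; for fixed \<open>z\<close>, \<open>average_radial\<close> then replaces
  \<open>sgn z\<close> by \<open>a\<close>.\<close>

lemma nn_integral_ball_sgn:
  fixes a :: "real ^ 'n"
  assumes a: "norm a = 1" and [measurable]: "\<phi> \<in> borel_measurable borel"
  shows "(\<integral>\<^sup>+z. indicator (ball 0 1) z * \<phi> (sgn z) \<partial>lborel) =
    emeasure lborel (ball (0 :: real ^ 'n) 1) * (\<integral>\<^sup>+R. \<phi> (R *v a) \<partial>M)"
proof -
  have [measurable]: "ball 0 1 \<in> sets (borel :: (real ^ 'n) measure)" by simp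
  have [measurable]: "sgn \<in> borel_measurable (borel :: (real ^ 'n) measure)"
    unfolding sgn_div_norm by measurable
  have "(\<integral>\<^sup>+z. indicator (ball 0 1) z * \<phi> (sgn z) \<partial>lborel) =
    (\<integral>\<^sup>+R. \<integral>\<^sup>+z. indicator (ball 0 1) z * \<phi> (sgn z) \<partial>lborel \<partial>M)" by simp
  also have "\<dots> = (\<integral>\<^sup>+R. \<integral>\<^sup>+z. indicator (ball 0 1) z * \<phi> (R *v sgn z) \<partial>lborel \<partial>M)"
  proof (rule nn_integral_cong_AE, use AE_rotation in eventually_elim)
    case (elim R)
    have "(\<integral>\<^sup>+z. indicator (ball 0 1) z * \<phi> (R *v sgn z) \<partial>lborel) =
        (\<integral>\<^sup>+z. indicator (ball 0 1) (R *v z) * \<phi> (sgn (R *v z)) \<partial>lborel)"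
      by (simp add: rotation_matrix_norm[OF elim] rotation_matrix_sgn[OF elim] indicator_def)
    also have "\<dots> = (\<integral>\<^sup>+z. indicator (ball 0 1) z * \<phi> (sgn z) \<partial>lborel)"
      by (rule nn_integral_lborel_orthogonal[OF rotation_matrix_orthogonal_transformation[OF elim],
          of "\<lambda>z. indicator (ball 0 1) z * \<phi> (sgn z)"]) measurable
    finally show ?case by simp
  qed
  also have "\<dots> = (\<integral>\<^sup>+z. \<integral>\<^sup>+R. indicator (ball 0 1) z * \<phi> (R *v sgn z) \<partial>M \<partial>lborel)"
    by (rule Fubini_lborel) measurable
  also have "\<dots> = (\<integral>\<^sup>+z. indicator (ball 0 1) z * (\<integral>\<^sup>+R. \<phi> (R *v sgn z) \<partial>M) \<partial>lborel)"
    by (subst nn_integral_cmult) auto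
  also have "\<dots> = (\<integral>\<^sup>+z. (\<integral>\<^sup>+R. \<phi> (R *v a) \<partial>M) * indicator (ball 0 1) z \<partial>(lborel :: (real ^ 'n) measure))"
  proof (rule nn_integral_cong_AE)
    show "AE z in lborel. indicator (ball 0 1) z * (\<integral>\<^sup>+R. \<phi> (R *v sgn z) \<partial>M) =
        (\<integral>\<^sup>+R. \<phi> (R *v a) \<partial>M) * indicator (ball 0 1) (z :: real ^ 'n)"
      using AE_lborel_singleton[of 0]
    proof eventually_elim
      case (elim z)
      then have "norm (sgn z) = norm a" by (simp add: norm_sgn a)
      from average_radial[OF this, of \<phi>] show ?case by (simp add: mult.commute)
    qed
  qed
  also have "\<dots> = emeasure lborel (ball (0 :: real ^ 'n) 1) * (\<integral>\<^sup>+R. \<phi> (R *v a) \<partial>M)"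
    by (subst nn_integral_cmult_indicator) (auto simp: mult.commute)
  finally show ?thesis .
qed

text \<open>After averaging over rotations only the distribution of the length of the difference matters,
  which is controlled by \<open>nn_integral_cap_le\<close>.\<close>

lemma sphere_difference_density:
  obtains C :: real where "C > 0"
    and "\<And>a b \<psi>. \<lbrakk>norm a = 1; norm b = 1; \<psi> \<in> borel_measurable borel\<rbrakk> \<Longrightarrow>
      (\<integral>\<^sup>+Q. \<integral>\<^sup>+R. \<psi> (Q *v b - R *v a) \<partial>M \<partial>M) \<le> ennreal C * (\<integral>\<^sup>+z. \<psi> z * inv_kernel (z :: real ^ 'n) \<partial>lborel)"
proof -
  define n where "n = CARD('n)"
  define v where "v = unit_ball_vol n"
  have v0: "v > 0" by (simp add: v_def)
  have n0: "n > 0" using card3 by (simp add: n_def)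
  \<comment> \<open>Dividing the cap weight \<open>2 ^ (n + 1) * \<rho> ^ (n - 2)\<close> by the
    polar weight \<open>n * v * \<rho> ^ (n - 1)\<close> leaves \<open>1 / \<rho>\<close> and a
    constant. The second \<open>v\<close> is the volume of the ball in
    \<open>nn_integral_ball_sgn\<close>.\<close>
  define C where "C = 2 ^ (n + 1) / (n * v * v)"
  have "C > 0" using v0 n0 by (simp add: C_def)
  moreover have "(\<integral>\<^sup>+Q. \<integral>\<^sup>+R. \<psi> (Q *v b - R *v a) \<partial>M \<partial>M) \<le> ennreal C * (\<integral>\<^sup>+z. \<psi> z * inv_kernel z \<partial>lborel)"
    if a: "norm a = 1" and b: "norm b = 1" and \<psi>[measurable]: "\<psi> \<in> borel_measurable borel"
    for a b and \<psi> :: "real ^ 'n \<Rightarrow> ennreal"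
  proof -
    define e :: "real ^ 'n" where "e = axis undefined 1"
    have e: "norm e = 1" "e \<in> Basis" by (auto simp: e_def Basis_vec_def)
    define \<Psi> where "\<Psi> y = (\<integral>\<^sup>+Q. \<psi> (Q *v y) \<partial>M)" for y
    define \<Psi>0 where "\<Psi>0 \<rho> = \<Psi> (\<rho> *\<^sub>R e)" for \<rho>
    have \<Psi>m[measurable]: "\<Psi> \<in> borel_measurable borel" unfolding \<Psi>_def by measurable
    have \<Psi>0m[measurable]: "\<Psi>0 \<in> borel_measurable borel" unfolding \<Psi>0_def by measurable
    have radial: "\<Psi> y = \<Psi>0 (norm y)" for y
      unfolding \<Psi>0_def \<Psi>_def by (rule average_radial) (auto simp: e)
    obtain f where f: "orthogonal_transformation f" "det (matrix f) = 1" "f b = e"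
      using rotation_exists[of b e] card3 b e by auto
    then have P: "rotation_matrix (matrix f)" "matrix f *v b = e"
      by (auto simp: rotation_matrix_def orthogonal_transformation_matrix orthogonal_transformation_linear)
    have ball_v: "emeasure lborel (ball (0 :: real ^ 'n) 1) = ennreal v"
      by (simp add: emeasure_ball v_def n_def)
    \<comment> \<open>Replacing \<open>R\<close> by \<open>Q ** R\<close> makes \<open>Q\<close> act
      on the whole difference, so that averaging over \<open>Q\<close> gives the radial function
      \<open>\<Psi>\<close>.\<close>
    have "(\<integral>\<^sup>+Q. \<integral>\<^sup>+R. \<psi> (Q *v b - R *v a) \<partial>M \<partial>M) = (\<integral>\<^sup>+Q. \<integral>\<^sup>+R. \<psi> (Q *v (b - R *v a)) \<partial>M \<partial>M)"
    proof (rule nn_integral_cong_AE, use AE_rotation in eventually_elim)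
      case (elim Q)
      show ?case
        using left_invariant[OF elim, of "\<lambda>R. \<psi> (Q *v b - R *v a)"]
        by (simp add: matrix_vector_mul_assoc matrix_vector_mult_diff_distrib)
    qed
    also have "\<dots> = (\<integral>\<^sup>+R. \<Psi> (b - R *v a) \<partial>M)"
      unfolding \<Psi>_def by (rule Fubini_M) measurable
    \<comment> \<open>The unit vector \<open>b\<close> is rotated to the basis vector
      \<open>e\<close>, the position in which the cap estimate is stated.\<close>
    also have "\<dots> = (\<integral>\<^sup>+R. \<Psi>0 (norm (e - (matrix f ** R) *v a)) \<partial>M)"
    proof (intro nn_integral_cong)
      fix R
      have "norm (e - (matrix f ** R) *v a) = norm (matrix f *v (b - R *v a))"
        by (simp add: matrix_vector_mul_assoc matrix_vector_mult_diff_distrib P)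
      then show "\<Psi> (b - R *v a) = \<Psi>0 (norm (e - (matrix f ** R) *v a))"
        by (simp add: radial rotation_matrix_norm[OF P(1)])
    qed
    also have "\<dots> = (\<integral>\<^sup>+R. \<Psi>0 (norm (e - R *v a)) \<partial>M)"
      by (rule left_invariant[OF P(1), of "\<lambda>R. \<Psi>0 (norm (e - R *v a))"]) measurable
    finally have I: "(\<integral>\<^sup>+Q. \<integral>\<^sup>+R. \<psi> (Q *v b - R *v a) \<partial>M \<partial>M) = \<dots>" .
    have "ennreal v * (\<integral>\<^sup>+R. \<Psi>0 (norm (e - R *v a)) \<partial>M) =
        (\<integral>\<^sup>+z. indicator (ball 0 1) z * \<Psi>0 (norm (e - sgn z)) \<partial>lborel)"
      using nn_integral_ball_sgn[OF a, of "\<lambda>y. \<Psi>0 (norm (e - y))"] by (simp add: ball_v)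
    also have "\<dots> \<le> (\<integral>\<^sup>+\<rho>. ennreal (2 ^ (n + 1) * \<rho> ^ (n - 2)) * indicator {0..2} \<rho> * \<Psi>0 \<rho> \<partial>lborel)"
      using nn_integral_cap_le[OF e(2) _ \<Psi>0m] card3 by (simp add: n_def)
    also have "\<dots> = (\<integral>\<^sup>+\<rho>. ennreal (2 ^ (n + 1) / (n * v)) *
        (ennreal (n * v * \<rho> ^ (n - 1)) * indicator {0..} \<rho> * (\<Psi>0 \<rho> * (ennreal (1 / \<rho>) * indicator {0..2} \<rho>))) \<partial>lborel)"
    proof (intro nn_integral_cong)
      fix \<rho> :: real
      show "ennreal (2 ^ (n + 1) * \<rho> ^ (n - 2)) * indicator {0..2} \<rho> * \<Psi>0 \<rho> = ennreal (2 ^ (n + 1) / (n * v)) *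
        (ennreal (n * v * \<rho> ^ (n - 1)) * indicator {0..} \<rho> * (\<Psi>0 \<rho> * (ennreal (1 / \<rho>) * indicator {0..2} \<rho>)))"
      proof (cases "\<rho> > 0")
        case True
        have m3: "ennreal (x * y * z) = ennreal x * ennreal y * ennreal z" if "x \<ge> 0" "y \<ge> 0" "z \<ge> 0" for x y z
          using that by (simp add: ennreal_mult)
        have n1: "n - 1 = Suc (n - 2)" using card3 by (simp add: n_def)
        have "2 ^ (n + 1) * \<rho> ^ (n - 2) = 2 ^ (n + 1) / (n * v) * (n * v * \<rho> ^ (n - 1)) * (1 / \<rho>)"
          using True v0 n0 unfolding n1 by simp
        then have eq: "ennreal (2 ^ (n + 1) * \<rho> ^ (n - 2)) =
            ennreal (2 ^ (n + 1) / (n * v)) * ennreal (n * v * \<rho> ^ (n - 1)) * ennreal (1 / \<rho>)"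
          by (rule ssubst, intro m3 divide_nonneg_nonneg mult_nonneg_nonneg zero_le_power)
            (use True v0 in simp_all)
        have i1: "indicator {0..} \<rho> = (1 :: ennreal)" using True by simp
        have ac: "x * y * z * u * p = x * (y * 1 * (p * (z * u)))" for x y z u p :: ennreal
          by (simp add: mult_ac)
        show ?thesis unfolding eq i1 by (rule ac)
      next
        case False
        have "\<rho> = 0 \<Longrightarrow> \<rho> ^ (n - 2) = 0" using card3 by (simp add: n_def)
        with False show ?thesis by (cases "\<rho> = 0") simp_all
      qed
    qed
    also have "\<dots> = ennreal (2 ^ (n + 1) / (n * v)) * (\<integral>\<^sup>+z. \<Psi>0 (norm z) * (ennreal (1 / norm z) * indicator {0..2} (norm z)) \<partial>(lborel :: (real ^ 'n) measure))"
      using nn_integral_norm_polar[where 'a="real ^ 'n", of "\<lambda>\<rho>. \<Psi>0 \<rho> * (ennreal (1 / \<rho>) * indicator {0..2} \<rho>)"]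
      by (subst nn_integral_cmult) (auto simp: n_def v_def)
    also have "(\<integral>\<^sup>+z. \<Psi>0 (norm z) * (ennreal (1 / norm z) * indicator {0..2} (norm z)) \<partial>(lborel :: (real ^ 'n) measure)) =
        (\<integral>\<^sup>+z. \<integral>\<^sup>+Q. \<psi> (Q *v z) * inv_kernel z \<partial>M \<partial>lborel)"
      by (subst nn_integral_multc)
        (auto simp: radial[symmetric] \<Psi>_def inv_kernel_def intro!: nn_integral_cong split: split_indicator)
    also have "\<dots> = (\<integral>\<^sup>+Q. \<integral>\<^sup>+z. \<psi> (Q *v z) * inv_kernel z \<partial>lborel \<partial>M)"
      by (rule Fubini_lborel[symmetric]) measurable
    \<comment> \<open>The kernel is radial and Lebesgue measure is invariant, so the averaging over
      \<open>Q\<close> can be undone.\<close>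
    also have "\<dots> = (\<integral>\<^sup>+Q. \<integral>\<^sup>+z. \<psi> z * inv_kernel z \<partial>lborel \<partial>M)"
    proof (rule nn_integral_cong_AE, use AE_rotation in eventually_elim)
      case (elim Q)
      have "inv_kernel (Q *v z) = inv_kernel z" for z
        using rotation_matrix_norm[OF elim] by (simp add: inv_kernel_def indicator_def)
      then show ?case
        using nn_integral_lborel_orthogonal[OF rotation_matrix_orthogonal_transformation[OF elim],
          of "\<lambda>z. \<psi> z * inv_kernel z"] by simp
    qed
    finally have le: "ennreal v * (\<integral>\<^sup>+R. \<Psi>0 (norm (e - R *v a)) \<partial>M) \<le>
        ennreal (2 ^ (n + 1) / (n * v)) * (\<integral>\<^sup>+z. \<psi> z * inv_kernel z \<partial>lborel)" by simp
    have "1 / v * v = 1" "1 / v * (2 ^ (n + 1) / (n * v)) = C"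
      using v0 by (simp_all add: C_def)
    then have c: "ennreal (1 / v) * ennreal v = 1" "ennreal (1 / v) * ennreal (2 ^ (n + 1) / (n * v)) = ennreal C"
      using v0 ennreal_mult'[of "1 / v"] by (metis divide_nonneg_pos ennreal_1 zero_le_one)+
    have "(\<integral>\<^sup>+R. \<Psi>0 (norm (e - R *v a)) \<partial>M) = ennreal (1 / v) * (ennreal v * (\<integral>\<^sup>+R. \<Psi>0 (norm (e - R *v a)) \<partial>M))"
      unfolding mult.assoc[symmetric] c by simp
    also have "\<dots> \<le> ennreal (1 / v) * (ennreal (2 ^ (n + 1) / (n * v)) * (\<integral>\<^sup>+z. \<psi> z * inv_kernel z \<partial>lborel))"
      by (intro mult_left_mono le) simp
    also have "\<dots> = ennreal C * (\<integral>\<^sup>+z. \<psi> z * inv_kernel z \<partial>lborel)"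
      unfolding mult.assoc[symmetric] c ..
    finally show ?thesis unfolding I .
  qed
  ultimately show ?thesis by (rule that)
qed

end

section \<open>Estimates with target \<open>L\<^sup>1\<close>\<close>

lemma ennreal_mult_le_sum_squares: "a * b \<le> a\<^sup>2 + b\<^sup>2" for a b :: ennreal
proof (cases "a \<le> b")
  case True
  then have "a * b \<le> b * b" by (rule mult_right_mono) simp
  then show ?thesis by (simp add: power2_eq_square add_increasing)
next
  case False
  then have "a * b \<le> a * a" by (intro mult_left_mono) auto
  then show ?thesis by (simp add: power2_eq_square add_increasing2)
qed

section \<open>Powers of functions of mass at most one\<close>

definition unit_mass :: "(real ^ 'n::finite \<Rightarrow> real) \<Rightarrow> bool" where
  "unit_mass F \<longleftrightarrow> F \<in> borel_measurable borel \<and> (\<forall>x. 0 \<le> F x) \<and> (\<integral>\<^sup>+x. ennreal (F x) \<partial>lborel) \<le> 1"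

text \<open>Since \<open>0 powr s = 0\<close> for every \<open>s\<close>, also for
  \<open>s = 0\<close>, the function \<open>pw F 0\<close> is the indicator of the set where
  \<open>F\<close> does not vanish, and powers multiply correctly even at the zeros of
  \<open>F\<close>.\<close>

definition pw :: "('a \<Rightarrow> real) \<Rightarrow> real \<Rightarrow> 'a \<Rightarrow> ennreal" where
  "pw F s x = ennreal (F x powr s)"

lemma pw_measurable [measurable]:
  "F \<in> borel_measurable borel \<Longrightarrow> pw F s \<in> borel_measurable borel"
  unfolding pw_def by measurable

lemma pw_0_le: "pw F 0 x \<le> 1"
  by (simp add: pw_def)

lemma pw_mult: "pw F s x * pw F t x = pw F (s + t) x"
  by (simp add: pw_def powr_add ennreal_mult')

lemma pw_square: "(pw F s x)\<^sup>2 = pw F (2 * s) x"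
  by (simp add: power2_eq_square pw_mult)

lemma pw_1: "0 \<le> F x \<Longrightarrow> pw F 1 x = ennreal (F x)"
  by (simp add: pw_def)

lemma unit_massD:
  assumes "unit_mass F"
  shows "F \<in> borel_measurable borel" and "0 \<le> F x" and "(\<integral>\<^sup>+x. pw F 1 x \<partial>lborel) \<le> 1"
  using assms by (auto simp: unit_mass_def pw_1)

text \<open>Regrouping the powers turns the product into \<open>X powr l * Y powr m\<close>, with
  \<open>X\<close> and \<open>Y\<close> the products at the two ends. Young's inequality is applied
  for positive \<open>X\<close> and \<open>Y\<close>; if one is 0, so is the left side.\<close>

lemma pw_convex_combination_le:
  fixes F G H :: "'a \<Rightarrow> real"
  assumes F: "0 \<le> F t" and G: "0 \<le> G t'" and H: "0 \<le> H t''"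
    and l: "0 < l" "0 < m" "l + m = 1"
  shows "pw F (l * x0 + m * x1) t * pw G (l * y0 + m * y1) t' * pw H (l * z0 + m * z1) t''
    \<le> ennreal l * (pw F x0 t * pw G y0 t' * pw H z0 t'') + ennreal m * (pw F x1 t * pw G y1 t' * pw H z1 t'')"
proof -
  define X where "X = F t powr x0 * G t' powr y0 * H t'' powr z0"
  define Y where "Y = F t powr x1 * G t' powr y1 * H t'' powr z1"
  have XY: "X \<ge> 0" "Y \<ge> 0" by (simp_all add: X_def Y_def)
  have "F t powr (l * x0 + m * x1) * G t' powr (l * y0 + m * y1) * H t'' powr (l * z0 + m * z1) = X powr l * Y powr m"
    by (simp add: X_def Y_def powr_mult powr_powr powr_add mult_ac)
  also have "\<dots> \<le> l * X + m * Y"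
  proof (cases "X = 0 \<or> Y = 0")
    case True
    then show ?thesis using XY l by auto
  next
    case False
    then show ?thesis using XY l by (intro Youngs_inequality_0) auto
  qed
  finally have "ennreal (F t powr (l * x0 + m * x1) * G t' powr (l * y0 + m * y1) * H t'' powr (l * z0 + m * z1)) \<le> ennreal (l * X + m * Y)"
    by (rule ennreal_leI)
  also have "ennreal (l * X + m * Y) = ennreal (l * X) + ennreal (m * Y)"
    using XY l by (intro ennreal_plus) auto
  also have "ennreal (l * X) = ennreal l * ennreal X" using l by (intro ennreal_mult') auto
  also have "ennreal (m * Y) = ennreal m * ennreal Y" using l by (intro ennreal_mult') auto
  finally show ?thesis
    unfolding pw_def X_def Y_def by (simp only: ennreal_mult powr_ge_zero mult_nonneg_nonneg)
qed

context rotation_average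
begin

definition avg :: "real ^ 'n \<Rightarrow> (real ^ 'n \<Rightarrow> ennreal) \<Rightarrow> real ^ 'n \<Rightarrow> ennreal" where
  "avg a \<phi> x = (\<integral>\<^sup>+R. \<phi> (x + R *v a) \<partial>M)"

lemma avg_measurable [measurable]:
  assumes [measurable]: "\<phi> \<in> borel_measurable borel"
  shows "avg a \<phi> \<in> borel_measurable borel"
  unfolding avg_def by measurable

text \<open>The two averages together run over independent rotations \<open>R\<close> and
  \<open>Q\<close>. Translating \<open>x\<close> by \<open>R *v a\<close> leaves only the difference
  \<open>Q *v b - R *v a\<close>, whose law is bounded by \<open>sphere_difference_density\<close>,
  applied to \<open>\<psi>\<close> shifted by \<open>x\<close>.\<close>

lemma bilinear_avg_le:
  obtains C :: real where "C > 0"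
    and "\<And>a b \<phi> \<psi>. \<lbrakk>norm a = 1; norm b = 1; \<phi> \<in> borel_measurable borel; \<psi> \<in> borel_measurable borel\<rbrakk> \<Longrightarrow>
      (\<integral>\<^sup>+x. avg a \<phi> x * avg b \<psi> x \<partial>lborel)
        \<le> ennreal C * (\<integral>\<^sup>+x. \<integral>\<^sup>+z. \<phi> x * (\<psi> (x + z) * inv_kernel z) \<partial>lborel \<partial>lborel)"
proof -
  obtain C :: real where C: "C > 0"
    and D: "\<And>a b \<psi>. \<lbrakk>norm a = 1; norm b = 1; \<psi> \<in> borel_measurable borel\<rbrakk> \<Longrightarrow>
      (\<integral>\<^sup>+Q. \<integral>\<^sup>+R. \<psi> (Q *v b - R *v a) \<partial>M \<partial>M) \<le> ennreal C * (\<integral>\<^sup>+z. \<psi> z * inv_kernel (z :: real ^ 'n) \<partial>lborel)"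
    using sphere_difference_density by blast
  have "(\<integral>\<^sup>+x. avg a \<phi> x * avg b \<psi> x \<partial>lborel)
      \<le> ennreal C * (\<integral>\<^sup>+x. \<integral>\<^sup>+z. \<phi> x * (\<psi> (x + z) * inv_kernel z) \<partial>lborel \<partial>lborel)"
    if a: "norm a = 1" and b: "norm b = 1"
      and \<phi>[measurable]: "\<phi> \<in> borel_measurable borel" and \<psi>[measurable]: "\<psi> \<in> borel_measurable borel"
    for a b \<phi> \<psi>
  proof -
    have "(\<integral>\<^sup>+x. avg a \<phi> x * avg b \<psi> x \<partial>lborel) =
        (\<integral>\<^sup>+x. \<integral>\<^sup>+Q. \<integral>\<^sup>+R. \<phi> (x + R *v a) * \<psi> (x + Q *v b) \<partial>M \<partial>M \<partial>lborel)"
      unfolding avg_def by (simp add: nn_integral_cmult nn_integral_multc)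
    also have "\<dots> = (\<integral>\<^sup>+Q. \<integral>\<^sup>+x. \<integral>\<^sup>+R. \<phi> (x + R *v a) * \<psi> (x + Q *v b) \<partial>M \<partial>lborel \<partial>M)"
      by (rule Fubini_lborel[symmetric]) measurable
    also have "\<dots> = (\<integral>\<^sup>+Q. \<integral>\<^sup>+R. \<integral>\<^sup>+x. \<phi> (x + R *v a) * \<psi> (x + Q *v b) \<partial>lborel \<partial>M \<partial>M)"
      by (intro nn_integral_cong Fubini_lborel[symmetric]) measurable
    also have "\<dots> = (\<integral>\<^sup>+Q. \<integral>\<^sup>+R. \<integral>\<^sup>+x. \<phi> x * \<psi> (x + (Q *v b - R *v a)) \<partial>lborel \<partial>M \<partial>M)"
    proof (rule nn_integral_cong, rule nn_integral_cong)
      fix Q R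
      show "(\<integral>\<^sup>+x. \<phi> (x + R *v a) * \<psi> (x + Q *v b) \<partial>lborel) = (\<integral>\<^sup>+x. \<phi> x * \<psi> (x + (Q *v b - R *v a)) \<partial>lborel)"
        using nn_integral_lborel_shift[of "\<lambda>x. \<phi> x * \<psi> (x + (Q *v b - R *v a))" "R *v a"]
        by (simp add: algebra_simps)
    qed
    also have "\<dots> = (\<integral>\<^sup>+Q. \<integral>\<^sup>+x. \<integral>\<^sup>+R. \<phi> x * \<psi> (x + (Q *v b - R *v a)) \<partial>M \<partial>lborel \<partial>M)"
      by (intro nn_integral_cong Fubini_lborel) measurable
    also have "\<dots> = (\<integral>\<^sup>+x. \<integral>\<^sup>+Q. \<integral>\<^sup>+R. \<phi> x * \<psi> (x + (Q *v b - R *v a)) \<partial>M \<partial>M \<partial>lborel)"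
      by (rule Fubini_lborel) measurable
    also have "\<dots> = (\<integral>\<^sup>+x. \<phi> x * (\<integral>\<^sup>+Q. \<integral>\<^sup>+R. \<psi> (x + (Q *v b - R *v a)) \<partial>M \<partial>M) \<partial>lborel)"
      by (simp add: nn_integral_cmult)
    also have "\<dots> \<le> (\<integral>\<^sup>+x. \<phi> x * (ennreal C * (\<integral>\<^sup>+z. \<psi> (x + z) * inv_kernel z \<partial>lborel)) \<partial>lborel)"
    proof (intro nn_integral_mono mult_left_mono)
      show "(\<integral>\<^sup>+Q. \<integral>\<^sup>+R. \<psi> (x + (Q *v b - R *v a)) \<partial>M \<partial>M)
          \<le> ennreal C * (\<integral>\<^sup>+z. \<psi> (x + z) * inv_kernel z \<partial>lborel)" for x
        by (rule D[OF a b, of "\<lambda>z. \<psi> (x + z)"]) measurable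
    qed simp
    also have "\<dots> = ennreal C * (\<integral>\<^sup>+x. \<integral>\<^sup>+z. \<phi> x * (\<psi> (x + z) * inv_kernel z) \<partial>lborel \<partial>lborel)"
      by (simp add: nn_integral_cmult mult.left_commute)
    finally show ?thesis .
  qed
  with C show ?thesis by (rule that)
qed

section \<open>The trilinear form and its symmetries\<close>

definition tri_avg where
  "tri_avg u v w f g h x = (\<integral>\<^sup>+R. f (x - R *v u) * g (x - R *v v) * h (x - R *v w) \<partial>M)"

lemma tri_avg_measurable [measurable]:
  assumes [measurable]: "f \<in> borel_measurable borel" "g \<in> borel_measurable borel" "h \<in> borel_measurable borel"
  shows "tri_avg u v w f g h \<in> borel_measurable borel"
  unfolding tri_avg_def by measurable

text \<open>The triple consists of the reciprocals of the exponents p, q, s. The points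
  \<open>u\<close>, \<open>v\<close>, \<open>w\<close> are parameters because permuting the
  functions permutes them as well.\<close>

definition L1_bounded :: "real ^ 'n \<Rightarrow> real ^ 'n \<Rightarrow> real ^ 'n \<Rightarrow> real \<times> real \<times> real \<Rightarrow> bool" where
  "L1_bounded u v w = (\<lambda>(x, y, z). \<exists>C::real. \<forall>F G H. unit_mass F \<longrightarrow> unit_mass G \<longrightarrow> unit_mass H \<longrightarrow>
     (\<integral>\<^sup>+t. tri_avg u v w (pw F x) (pw G y) (pw H z) t \<partial>lborel) \<le> ennreal C)"

lemma tri_avg_swap12: "tri_avg u v w f g h = tri_avg v u w g f h"
  unfolding tri_avg_def by (rule ext) (simp only: mult.commute[of "f _"])

lemma tri_avg_swap23: "tri_avg u v w f g h = tri_avg u w v f h g"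
  unfolding tri_avg_def by (rule ext) (simp only: mult.assoc mult.commute[of "g _"])

lemma L1_bounded_swap12: "L1_bounded u v w (x, y, z) \<Longrightarrow> L1_bounded v u w (y, x, z)"
  unfolding L1_bounded_def prod.case tri_avg_swap12[of v] by blast

lemma L1_bounded_swap23: "L1_bounded u v w (x, y, z) \<Longrightarrow> L1_bounded u w v (x, z, y)"
  unfolding L1_bounded_def prod.case tri_avg_swap23[of u w] by blast

text \<open>Translating \<open>x\<close> by \<open>R *v u\<close> makes the first function
  independent of \<open>R\<close>, so that it can be taken out of the average. The other two see
  only the edge vectors at \<open>u\<close>.\<close>

lemma nn_integral_tri_avg:
  assumes [measurable]: "f \<in> borel_measurable borel" "g \<in> borel_measurable borel" "h \<in> borel_measurable borel"
  shows "(\<integral>\<^sup>+x. tri_avg u v w f g h x \<partial>lborel) =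
    (\<integral>\<^sup>+x. \<integral>\<^sup>+R. f x * (g (x + R *v (u - v)) * h (x + R *v (u - w))) \<partial>M \<partial>lborel)"
proof -
  have "(\<integral>\<^sup>+x. tri_avg u v w f g h x \<partial>lborel) =
      (\<integral>\<^sup>+R. \<integral>\<^sup>+x. f (x - R *v u) * g (x - R *v v) * h (x - R *v w) \<partial>lborel \<partial>M)"
    unfolding tri_avg_def by (rule Fubini_lborel[symmetric]) measurable
  also have "\<dots> = (\<integral>\<^sup>+R. \<integral>\<^sup>+x. f x * (g (x + R *v (u - v)) * h (x + R *v (u - w))) \<partial>lborel \<partial>M)"
  proof (rule nn_integral_cong)
    fix R
    show "(\<integral>\<^sup>+x. f (x - R *v u) * g (x - R *v v) * h (x - R *v w) \<partial>lborel) =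
        (\<integral>\<^sup>+x. f x * (g (x + R *v (u - v)) * h (x + R *v (u - w))) \<partial>lborel)"
      using nn_integral_lborel_shift[of "\<lambda>x. f (x - R *v u) * g (x - R *v v) * h (x - R *v w)" "R *v u"]
      by (simp add: matrix_vector_mult_diff_distrib add_diff_eq add.commute mult.assoc)
  qed
  also have "\<dots> = (\<integral>\<^sup>+x. \<integral>\<^sup>+R. f x * (g (x + R *v (u - v)) * h (x + R *v (u - w))) \<partial>M \<partial>lborel)"
    by (rule Fubini_lborel) measurable
  finally show ?thesis .
qed

lemma L1_bounded_100: "L1_bounded u v w (1, 0, 0)"
proof -
  have "(\<integral>\<^sup>+x. tri_avg u v w (pw F 1) (pw G 0) (pw H 0) x \<partial>lborel) \<le> ennreal 1"
    if FGH: "unit_mass F" "unit_mass G" "unit_mass H" for F G H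
  proof -
    note [measurable] = FGH[THEN unit_massD(1)]
    have "(\<integral>\<^sup>+x. tri_avg u v w (pw F 1) (pw G 0) (pw H 0) x \<partial>lborel) \<le>
      (\<integral>\<^sup>+x. \<integral>\<^sup>+R. pw F 1 x * (1 * 1) \<partial>M \<partial>lborel)"
      by (subst nn_integral_tri_avg, measurable) (intro nn_integral_mono mult_mono pw_0_le; simp)
    also have "\<dots> \<le> 1" using unit_massD(3)[OF FGH(1)] by simp
    finally show ?thesis by simp
  qed
  then show ?thesis unfolding L1_bounded_def by blast
qed

text \<open>After splitting off \<open>F\<close>, the square of \<open>avg a g\<close> has to be
  integrated, where \<open>g\<close> is the power 3/4 of \<open>G\<close>. By
  \<open>bilinear_avg_le\<close> this is a convolution form of \<open>g\<close> with itself and the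
  square-integrable \<open>inv_kernel\<close>, an instance of Young's inequality that is proved here
  by pointwise bounds.\<close>

lemma L1_bounded_pair:
  assumes uv: "norm (u - v) = 1"
  shows "L1_bounded u v w (1/2, 3/4, 0)"
proof -
  obtain C :: real where C: "C > 0" and B: "\<And>a b \<phi> \<psi>. \<lbrakk>norm a = 1; norm b = 1; \<phi> \<in> borel_measurable borel; \<psi> \<in> borel_measurable borel\<rbrakk> \<Longrightarrow>
      (\<integral>\<^sup>+x. avg a \<phi> x * avg b \<psi> x \<partial>lborel)
        \<le> ennreal C * (\<integral>\<^sup>+x. \<integral>\<^sup>+z. \<phi> x * (\<psi> (x + z) * inv_kernel z) \<partial>lborel \<partial>lborel)"
    using bilinear_avg_le by blast
  obtain c :: real where c0: "c \<ge> 0" and c: "(\<integral>\<^sup>+z. inv_kernel z * inv_kernel (z :: real ^ 'n) \<partial>lborel) \<le> ennreal c"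
    using nn_integral_inv_kernel_square[where 'a="real ^ 'n"] card3 by auto
  have "(\<integral>\<^sup>+x. tri_avg u v w (pw F (1/2)) (pw G (3/4)) (pw H 0) x \<partial>lborel) \<le> ennreal (1 + C * (1 + (c + c)))"
    if FGH: "unit_mass F" "unit_mass G" "unit_mass H" for F G H
  proof -
    note [measurable] = FGH[THEN unit_massD(1)]
    define a where "a = u - v"
    have a: "norm a = 1" using uv by (simp add: a_def)
    define g where "g = pw G (3/4)"
    have gm[measurable]: "g \<in> borel_measurable borel" unfolding g_def by measurable
    have G1: "(\<integral>\<^sup>+z. pw G 1 (x + z) \<partial>lborel) \<le> 1" for x
      using unit_massD(3)[OF FGH(2)] by (subst nn_integral_lborel_shift) auto
    have G1': "(\<integral>\<^sup>+x. pw G 1 (x + z) \<partial>lborel) \<le> 1" for z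
      using G1[of z] by (simp add: add.commute)
    have point: "g x * (g (x + z) * inv_kernel z) \<le>
        pw G 1 x * pw G 1 (x + z) + (pw G 1 x * (inv_kernel z * inv_kernel z) + pw G 1 (x + z) * (inv_kernel z * inv_kernel z))" for x z
    proof -
      let ?K = "inv_kernel z"
      have s1: "g t = pw G (1/2) t * pw G (1/4) t" for t by (simp add: g_def pw_mult)
      \<comment> \<open>The split 3/4 = 1/2 + 1/4 makes the square of the first bracket integrable
        by itself. The square of the second has exponents 1/2 beside the square of the kernel, and a
        second use of the inequality turns them into exponent 1 at a single point.\<close>
      have "g x * (g (x + z) * ?K) = (pw G (1/2) x * pw G (1/2) (x + z)) * (pw G (1/4) x * pw G (1/4) (x + z) * ?K)"
        unfolding s1 by (simp only: mult_ac)
      also have "\<dots> \<le> (pw G (1/2) x * pw G (1/2) (x + z))\<^sup>2 + (pw G (1/4) x * pw G (1/4) (x + z) * ?K)\<^sup>2"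
        by (rule ennreal_mult_le_sum_squares)
      also have "\<dots> = pw G 1 x * pw G 1 (x + z) + (pw G (1/2) x * pw G (1/2) (x + z)) * (?K * ?K)"
        by (simp add: power_mult_distrib pw_square power2_eq_square[of ?K])
      also have "pw G (1/2) x * pw G (1/2) (x + z) \<le> pw G 1 x + pw G 1 (x + z)"
        using ennreal_mult_le_sum_squares[of "pw G (1/2) x" "pw G (1/2) (x + z)"] by (simp add: pw_square)
      finally show ?thesis by (simp add: distrib_right add_left_mono mult_right_mono)
    qed
    have "(\<integral>\<^sup>+x. \<integral>\<^sup>+z. g x * (g (x + z) * inv_kernel z) \<partial>lborel \<partial>lborel) \<le>
      (\<integral>\<^sup>+x. \<integral>\<^sup>+z. pw G 1 x * pw G 1 (x + z) + (pw G 1 x * (inv_kernel z * inv_kernel z) + pw G 1 (x + z) * (inv_kernel z * inv_kernel z)) \<partial>lborel \<partial>lborel)"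
      by (intro nn_integral_mono point)
    also have "\<dots> = (\<integral>\<^sup>+x. \<integral>\<^sup>+z. pw G 1 x * pw G 1 (x + z) \<partial>lborel \<partial>lborel) +
       ((\<integral>\<^sup>+x. \<integral>\<^sup>+z. pw G 1 x * (inv_kernel z * inv_kernel (z :: real ^ 'n)) \<partial>lborel \<partial>lborel) +
        (\<integral>\<^sup>+x. \<integral>\<^sup>+z. pw G 1 (x + z) * (inv_kernel z * inv_kernel z) \<partial>lborel \<partial>lborel))"
      by (simp add: nn_integral_add)
    also have "\<dots> \<le> 1 + (ennreal c + ennreal c)"
    proof (intro add_mono)
      have "(\<integral>\<^sup>+x. \<integral>\<^sup>+z. pw G 1 x * pw G 1 (x + z) \<partial>lborel \<partial>lborel) \<le> (\<integral>\<^sup>+x. pw G 1 x * 1 \<partial>lborel)"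
      proof (rule nn_integral_mono)
        fix x
        have "(\<integral>\<^sup>+z. pw G 1 x * pw G 1 (x + z) \<partial>lborel) = pw G 1 x * (\<integral>\<^sup>+z. pw G 1 (x + z) \<partial>lborel)"
          by (rule nn_integral_cmult) measurable
        then show "(\<integral>\<^sup>+z. pw G 1 x * pw G 1 (x + z) \<partial>lborel) \<le> pw G 1 x * 1"
          using mult_left_mono[OF G1, of "pw G 1 x" x] by simp
      qed
      then show "(\<integral>\<^sup>+x. \<integral>\<^sup>+z. pw G 1 x * pw G 1 (x + z) \<partial>lborel \<partial>lborel) \<le> 1"
        using unit_massD(3)[OF FGH(2)] by simp
      have "(\<integral>\<^sup>+x. \<integral>\<^sup>+z. pw G 1 x * (inv_kernel z * inv_kernel (z :: real ^ 'n)) \<partial>lborel \<partial>lborel) =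
          (\<integral>\<^sup>+x. pw G 1 x \<partial>lborel) * (\<integral>\<^sup>+z. inv_kernel z * inv_kernel (z :: real ^ 'n) \<partial>lborel)"
        by (simp add: nn_integral_cmult nn_integral_multc)
      also have "\<dots> \<le> 1 * ennreal c"
        using unit_massD(3)[OF FGH(2)] c by (intro mult_mono) auto
      finally show "(\<integral>\<^sup>+x. \<integral>\<^sup>+z. pw G 1 x * (inv_kernel z * inv_kernel (z :: real ^ 'n)) \<partial>lborel \<partial>lborel) \<le> ennreal c" by simp
      have "(\<integral>\<^sup>+x. \<integral>\<^sup>+z. pw G 1 (x + z) * (inv_kernel z * inv_kernel z) \<partial>lborel \<partial>lborel) =
          (\<integral>\<^sup>+z. (\<integral>\<^sup>+x. pw G 1 (x + z) \<partial>lborel) * (inv_kernel z * inv_kernel z) \<partial>lborel)"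
        by (subst lborel_Fubini) (auto simp: nn_integral_multc)
      also have "\<dots> \<le> (\<integral>\<^sup>+z. 1 * (inv_kernel z * inv_kernel (z :: real ^ 'n)) \<partial>lborel)"
        by (intro nn_integral_mono mult_right_mono G1') simp
      finally show "(\<integral>\<^sup>+x. \<integral>\<^sup>+z. pw G 1 (x + z) * (inv_kernel z * inv_kernel z) \<partial>lborel \<partial>lborel) \<le> ennreal c"
        using c by simp
    qed
    finally have I: "(\<integral>\<^sup>+x. \<integral>\<^sup>+z. g x * (g (x + z) * inv_kernel z) \<partial>lborel \<partial>lborel) \<le> 1 + (ennreal c + ennreal c)" .
    have "(\<integral>\<^sup>+x. tri_avg u v w (pw F (1/2)) (pw G (3/4)) (pw H 0) x \<partial>lborel) \<le>
      (\<integral>\<^sup>+x. \<integral>\<^sup>+R. pw F (1/2) x * (g (x + R *v a) * 1) \<partial>M \<partial>lborel)"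
      unfolding g_def a_def
      by (subst nn_integral_tri_avg, measurable) (intro nn_integral_mono mult_mono pw_0_le order_refl; simp)
    also have "\<dots> = (\<integral>\<^sup>+x. pw F (1/2) x * avg a g x \<partial>lborel)"
      unfolding avg_def by (simp add: nn_integral_cmult)
    also have "\<dots> \<le> (\<integral>\<^sup>+x. pw F 1 x + avg a g x * avg a g x \<partial>lborel)"
      using ennreal_mult_le_sum_squares[of "pw F (1/2) x" "avg a g x" for x]
      by (intro nn_integral_mono) (simp add: pw_square power2_eq_square[of "avg a g _"])
    also have "\<dots> = (\<integral>\<^sup>+x. pw F 1 x \<partial>lborel) + (\<integral>\<^sup>+x. avg a g x * avg a g x \<partial>lborel)"
      by (simp add: nn_integral_add)
    also have "\<dots> \<le> 1 + ennreal C * (1 + (ennreal c + ennreal c))"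
      by (intro add_mono unit_massD(3)[OF FGH(1)] order_trans[OF B[OF a a gm gm]] mult_left_mono I) simp
    also have "\<dots> \<le> ennreal (1 + C * (1 + (c + c)))"
    proof -
      have "ennreal (1 + C * (1 + (c + c))) = ennreal 1 + ennreal (C * (1 + (c + c)))"
        by (rule ennreal_plus) (use C c0 in auto)
      also have "ennreal (C * (1 + (c + c))) = ennreal C * ennreal (1 + (c + c))"
        by (rule ennreal_mult) (use C c0 in auto)
      also have "ennreal (1 + (c + c)) = ennreal 1 + ennreal (c + c)"
        by (rule ennreal_plus) (use c0 in auto)
      also have "ennreal (c + c) = ennreal c + ennreal c"
        by (rule ennreal_plus) (use c0 in auto)
      finally show ?thesis by (simp only: ennreal_1 order_refl)
    qed
    finally show ?thesis .
  qed
  then show ?thesis unfolding L1_bounded_def by blast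
qed

text \<open>Restricting \<open>x + R a\<close> to a small ball around a point \<open>c\<close>, over which one averages, keeps the
  arguments of the last two functions apart, where \<open>inv_kernel\<close> is bounded.\<close>

lemma L1_bounded_half:
  assumes uv: "norm (u - v) = 1" and vw: "norm (v - w) = 1" and wu: "norm (w - u) = 1"
  shows "L1_bounded u v w (1/2, 1/2, 1/2)"
proof -
  obtain C :: real where C: "C > 0" and B: "\<And>a b \<phi> \<psi>. \<lbrakk>norm a = 1; norm b = 1; \<phi> \<in> borel_measurable borel; \<psi> \<in> borel_measurable borel\<rbrakk> \<Longrightarrow>
      (\<integral>\<^sup>+x. avg a \<phi> x * avg b \<psi> x \<partial>lborel)
        \<le> ennreal C * (\<integral>\<^sup>+x. \<integral>\<^sup>+z. \<phi> x * (\<psi> (x + z) * inv_kernel z) \<partial>lborel \<partial>lborel)"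
    using bilinear_avg_le by blast
  define a where "a = u - v"
  define b where "b = u - w"
  have a: "norm a = 1" and b: "norm b = 1" and ab: "norm (a - b) = 1"
    using assms by (simp_all add: a_def b_def norm_minus_commute)
  \<comment> \<open>With \<open>x + R *v a\<close> within 1/4 of \<open>c\<close>, the unit lengths
    of \<open>a\<close> and \<open>a - b\<close> put \<open>x\<close> within 5/4 of \<open>c\<close>
    and \<open>x + R *v b\<close> in the annulus \<open>W\<close> around \<open>c\<close>. Points of
    \<open>V\<close> and \<open>W\<close> are more than 1/2 apart, hence \<open>inv_kernel\<close>
    is at most 2.\<close>
  define U V W :: "(real ^ 'n) set" where "U = ball 0 2" and "V = ball 0 (1/4)" and "W = {y. 3/4 < norm y \<and> norm y < 5/4}"
  have [measurable]: "U \<in> sets borel" "V \<in> sets borel" by (simp_all add: U_def V_def)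
  have [measurable]: "W \<in> sets borel" unfolding W_def by measurable
  define \<beta>U \<beta>V where "\<beta>U = measure lborel U" and "\<beta>V = measure lborel V"
  have \<beta>: "emeasure lborel U = ennreal \<beta>U" "emeasure lborel V = ennreal \<beta>V" "\<beta>V > 0"
    by (simp_all add: \<beta>U_def \<beta>V_def U_def V_def emeasure_ball content_ball)
  have shift: "(\<integral>\<^sup>+c. indicator A (x - c) \<partial>lborel) = emeasure lborel A" if [measurable]: "A \<in> sets borel" for A and x :: "real ^ 'n"
    using nn_integral_lborel_reflect[of "indicator A" x] by simp
  have bound: "(\<integral>\<^sup>+x. tri_avg u v w (pw F (1/2)) (pw G (1/2)) (pw H (1/2)) x \<partial>lborel) \<le> ennreal ((\<beta>U + 2 * C * \<beta>V) / \<beta>V)"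
    if FGH: "unit_mass F" "unit_mass G" "unit_mass H" for F G H
  proof -
    note Fm[measurable] = FGH[THEN unit_massD(1)]
    define f g h where "f = pw F (1/2)" and "g = pw G (1/2)" and "h = pw H (1/2)"
    have [measurable]: "f \<in> borel_measurable borel" "g \<in> borel_measurable borel" "h \<in> borel_measurable borel"
      unfolding f_def g_def h_def by measurable
    have sq: "(f x)\<^sup>2 = pw F 1 x" "(g x)\<^sup>2 = pw G 1 x" "(h x)\<^sup>2 = pw H 1 x" for x
      by (simp_all add: f_def g_def h_def pw_square)
    define G' where "G' c y = pw G 1 y * indicator V (y - c)" for c y
    define H' where "H' c y = pw H 1 y * indicator W (y - c)" for c y
    have G'm[measurable]: "case_prod G' \<in> borel_measurable (borel \<Otimes>\<^sub>M borel)" unfolding G'_def by measurable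
    have H'm[measurable]: "case_prod H' \<in> borel_measurable (borel \<Otimes>\<^sub>M borel)" unfolding H'_def by measurable
    have G'c[measurable]: "G' c \<in> borel_measurable borel" for c unfolding G'_def by measurable
    have H'c[measurable]: "H' c \<in> borel_measurable borel" for c unfolding H'_def by measurable
    define J where "J c x = (\<integral>\<^sup>+R. (g (x + R *v a) * indicator V (x + R *v a - c)) * (h (x + R *v b) * indicator W (x + R *v b - c)) \<partial>M)" for c x
    have Jm[measurable]: "case_prod J \<in> borel_measurable (borel \<Otimes>\<^sub>M borel)" unfolding J_def by measurable
    \<comment> \<open>Cauchy-Schwarz in \<open>R\<close> decouples \<open>g\<close> from
      \<open>h\<close>: the two averages on the right have separate rotations. The cut-offs,
      inserted beforehand, still remember that the two arguments were apart.\<close>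
    have J2: "(J c x)\<^sup>2 \<le> avg a (G' c) x * avg b (H' c) x" for c x
    proof -
      have "indicator A y ^ 2 = (indicator A y :: ennreal)" for A and y :: "real ^ 'n" by (simp add: indicator_def)
      then show ?thesis
        using Cauchy_Schwarz_nn_integral[of "\<lambda>R. g (x + R *v a) * indicator V (x + R *v a - c)" M "\<lambda>R. h (x + R *v b) * indicator W (x + R *v b - c)"]
        by (simp add: J_def avg_def G'_def H'_def power_mult_distrib sq)
    qed
    \<comment> \<open>The bound is linear in the mass of \<open>G\<close> near \<open>c\<close>,
      which can be integrated over \<open>c\<close>; the mass of \<open>H\<close> is estimated by
      1.\<close>
    have GH: "(\<integral>\<^sup>+x. avg a (G' c) x * avg b (H' c) x \<partial>lborel) \<le> ennreal (2 * C) * (\<integral>\<^sup>+x. G' c x \<partial>lborel)" for c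
    proof -
      have sep: "G' c x * (H' c (x + z) * inv_kernel z) \<le> G' c x * (2 * pw H 1 (x + z))" for x z
      proof (cases "x - c \<in> V \<and> x + z - c \<in> W")
        case True
        then have "norm (x - c) < 1/4" "3/4 < norm ((x - c) + z)" by (simp_all add: V_def W_def algebra_simps)
        then have "1/2 \<le> norm z" using norm_triangle_ineq[of "x - c" z] by linarith
        then have "1 / norm z \<le> 2" using frac_le[of 1 1 "1/2" "norm z"] by simp
        then have "ennreal (1 / norm z) \<le> 2" using ennreal_leI by fastforce
        then have "inv_kernel z \<le> 2" by (simp add: inv_kernel_def indicator_def)
        then have "pw H 1 (x + z) * inv_kernel z \<le> pw H 1 (x + z) * 2" by (rule mult_left_mono) simp
        then show ?thesis using True by (intro mult_left_mono) (simp_all add: H'_def mult.commute)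
      qed (auto simp: G'_def H'_def)
      have H1: "(\<integral>\<^sup>+z. pw H 1 (x + z) \<partial>lborel) \<le> 1" for x
        using unit_massD(3)[OF FGH(3)] by (subst nn_integral_lborel_shift) auto
      have "(\<integral>\<^sup>+x. \<integral>\<^sup>+z. G' c x * (H' c (x + z) * inv_kernel z) \<partial>lborel \<partial>lborel) \<le>
          (\<integral>\<^sup>+x. \<integral>\<^sup>+z. G' c x * (2 * pw H 1 (x + z)) \<partial>lborel \<partial>lborel)"
        by (intro nn_integral_mono sep)
      also have "\<dots> = (\<integral>\<^sup>+x. G' c x * (2 * (\<integral>\<^sup>+z. pw H 1 (x + z) \<partial>lborel)) \<partial>lborel)"
        by (simp add: nn_integral_cmult)
      also have "\<dots> \<le> (\<integral>\<^sup>+x. G' c x * (2 * 1) \<partial>lborel)"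
        by (intro nn_integral_mono mult_left_mono H1) simp_all
      also have "\<dots> = 2 * (\<integral>\<^sup>+x. G' c x \<partial>lborel)"
        by (simp add: nn_integral_multc mult.commute)
      finally have "ennreal C * (\<integral>\<^sup>+x. \<integral>\<^sup>+z. G' c x * (H' c (x + z) * inv_kernel z) \<partial>lborel \<partial>lborel) \<le>
          ennreal C * (2 * (\<integral>\<^sup>+x. G' c x \<partial>lborel))" by (rule mult_left_mono) simp
      moreover have "ennreal C * (2 * (\<integral>\<^sup>+x. G' c x \<partial>lborel)) = ennreal (2 * C) * (\<integral>\<^sup>+x. G' c x \<partial>lborel)"
      proof -
        have ac: "p * (2 * q) = (2 * p) * q" for p q :: ennreal by (simp add: mult_ac)
        have "ennreal (2 * C) = 2 * ennreal C" using C by (simp add: ennreal_mult)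
        then show ?thesis by (simp only: ac)
      qed
      ultimately show ?thesis using B[OF a b G'c H'c, of c c] by simp
    qed
    \<comment> \<open>The factor \<open>\<beta>V\<close> is written as the integral over all centres
      \<open>c\<close> of the indicator that \<open>x + R *v a\<close> is within 1/4 of
      \<open>c\<close>.\<close>
    have "ennreal \<beta>V * (\<integral>\<^sup>+x. tri_avg u v w f g h x \<partial>lborel) =
        (\<integral>\<^sup>+x. \<integral>\<^sup>+R. \<integral>\<^sup>+c. f x * (g (x + R *v a) * h (x + R *v b)) * indicator V (x + R *v a - c) \<partial>lborel \<partial>M \<partial>lborel)"
      by (simp add: nn_integral_tri_avg a_def[symmetric] b_def[symmetric] nn_integral_cmult shift \<beta> nn_integral_multc mult.commute)
    also have "\<dots> \<le> (\<integral>\<^sup>+x. \<integral>\<^sup>+R. \<integral>\<^sup>+c. f x * indicator U (x - c) * ((g (x + R *v a) * indicator V (x + R *v a - c)) * (h (x + R *v b) * indicator W (x + R *v b - c))) \<partial>lborel \<partial>M \<partial>lborel)"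
    proof (rule nn_integral_mono, rule nn_integral_mono_AE, use AE_rotation in eventually_elim, rule nn_integral_mono)
      fix x c :: "real ^ 'n" and R :: "real ^ 'n ^ 'n" assume R: "rotation_matrix R"
      show "f x * (g (x + R *v a) * h (x + R *v b)) * indicator V (x + R *v a - c) \<le>
        f x * indicator U (x - c) * ((g (x + R *v a) * indicator V (x + R *v a - c)) * (h (x + R *v b) * indicator W (x + R *v b - c)))"
      proof (cases "x + R *v a - c \<in> V")
        case True
        define y where "y = x + R *v a - c"
        have y: "norm y < 1/4" using True by (simp add: V_def y_def)
        have n: "norm (R *v a) = 1" "norm (R *v (a - b)) = 1" using rotation_matrix_norm[OF R] a ab by simp_all
        have "x - c = y - R *v a" "x + R *v b - c = y - R *v (a - b)"
          by (simp_all add: y_def matrix_vector_mult_diff_distrib)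
        moreover have "norm (y - R *v a) < 2" using norm_triangle_ineq4[of y "R *v a"] y n by linarith
        moreover have "norm (y - R *v (a - b)) < 5/4" using norm_triangle_ineq4[of y "R *v (a - b)"] y n by linarith
        moreover have "3/4 < norm (y - R *v (a - b))" using norm_triangle_ineq3[of "R *v (a - b)" y] y n by (simp add: norm_minus_commute)
        ultimately have "x - c \<in> U" "x + R *v b - c \<in> W" by (simp_all add: U_def W_def)
        then show ?thesis using True by (simp add: mult.assoc)
      qed simp
    qed
    also have "\<dots> = (\<integral>\<^sup>+x. \<integral>\<^sup>+c. f x * indicator U (x - c) * J c x \<partial>lborel \<partial>lborel)"
    proof (rule nn_integral_cong)
      fix x
      have "(\<integral>\<^sup>+R. \<integral>\<^sup>+c. f x * indicator U (x - c) * ((g (x + R *v a) * indicator V (x + R *v a - c)) * (h (x + R *v b) * indicator W (x + R *v b - c))) \<partial>lborel \<partial>M) =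
        (\<integral>\<^sup>+c. \<integral>\<^sup>+R. f x * indicator U (x - c) * ((g (x + R *v a) * indicator V (x + R *v a - c)) * (h (x + R *v b) * indicator W (x + R *v b - c))) \<partial>M \<partial>lborel)"
        by (rule Fubini_lborel) measurable
      also have "\<dots> = (\<integral>\<^sup>+c. f x * indicator U (x - c) * J c x \<partial>lborel)"
        unfolding J_def by (subst nn_integral_cmult) auto
      finally show "(\<integral>\<^sup>+R. \<integral>\<^sup>+c. f x * indicator U (x - c) * ((g (x + R *v a) * indicator V (x + R *v a - c)) * (h (x + R *v b) * indicator W (x + R *v b - c))) \<partial>lborel \<partial>M) = \<dots>" .
    qed
    also have "\<dots> \<le> (\<integral>\<^sup>+x. \<integral>\<^sup>+c. pw F 1 x * indicator U (x - c) + avg a (G' c) x * avg b (H' c) x \<partial>lborel \<partial>lborel)"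
    proof (intro nn_integral_mono)
      fix x c
      have "f x * indicator U (x - c) * J c x \<le> (f x * indicator U (x - c))\<^sup>2 + (J c x)\<^sup>2"
        by (rule ennreal_mult_le_sum_squares)
      also have "(f x * indicator U (x - c))\<^sup>2 = pw F 1 x * indicator U (x - c)"
        by (simp add: power_mult_distrib sq indicator_def)
      finally show "f x * indicator U (x - c) * J c x \<le> pw F 1 x * indicator U (x - c) + avg a (G' c) x * avg b (H' c) x"
        using J2[of c x] by (meson add_left_mono order_trans)
    qed
    also have "\<dots> = (\<integral>\<^sup>+x. \<integral>\<^sup>+c. pw F 1 x * indicator U (x - c) \<partial>lborel \<partial>lborel) + (\<integral>\<^sup>+x. \<integral>\<^sup>+c. avg a (G' c) x * avg b (H' c) x \<partial>lborel \<partial>lborel)"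
      unfolding avg_def by (simp add: nn_integral_add)
    also have "(\<integral>\<^sup>+x. \<integral>\<^sup>+c. avg a (G' c) x * avg b (H' c) x \<partial>lborel \<partial>lborel) = (\<integral>\<^sup>+c. \<integral>\<^sup>+x. avg a (G' c) x * avg b (H' c) x \<partial>lborel \<partial>lborel)"
      unfolding avg_def by (rule lborel_Fubini) measurable
    also have "\<dots> \<le> (\<integral>\<^sup>+c. ennreal (2 * C) * (\<integral>\<^sup>+x. G' c x \<partial>lborel) \<partial>lborel)"
      by (intro nn_integral_mono GH)
    also have "\<dots> = ennreal (2 * C) * (\<integral>\<^sup>+c. \<integral>\<^sup>+x. G' c x \<partial>lborel \<partial>lborel)"
      by (simp add: nn_integral_cmult)
    also have "(\<integral>\<^sup>+c. \<integral>\<^sup>+x. G' c x \<partial>lborel \<partial>lborel) = (\<integral>\<^sup>+x. \<integral>\<^sup>+c. G' c x \<partial>lborel \<partial>lborel)"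
      by (rule lborel_Fubini) measurable
    also have "\<dots> = (\<integral>\<^sup>+x. pw G 1 x \<partial>lborel) * ennreal \<beta>V"
      unfolding G'_def by (simp add: nn_integral_cmult nn_integral_multc shift \<beta>)
    also have "(\<integral>\<^sup>+x. \<integral>\<^sup>+c. pw F 1 x * indicator U (x - c) \<partial>lborel \<partial>lborel) = (\<integral>\<^sup>+x. pw F 1 x \<partial>lborel) * ennreal \<beta>U"
      by (simp add: nn_integral_cmult nn_integral_multc shift \<beta>)
    also have "(\<integral>\<^sup>+x. pw F 1 x \<partial>lborel) * ennreal \<beta>U + ennreal (2 * C) * ((\<integral>\<^sup>+x. pw G 1 x \<partial>lborel) * ennreal \<beta>V)
        \<le> 1 * ennreal \<beta>U + ennreal (2 * C) * (1 * ennreal \<beta>V)"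
      by (intro add_mono mult_left_mono mult_right_mono unit_massD(3) FGH) simp_all
    also have "\<dots> = ennreal (\<beta>U + 2 * C * \<beta>V)"
    proof -
      have "\<beta>U \<ge> 0" by (simp add: \<beta>U_def)
      then have "ennreal (\<beta>U + 2 * C * \<beta>V) = ennreal \<beta>U + ennreal (2 * C * \<beta>V)"
        using C \<beta>(3) by (intro ennreal_plus) auto
      also have "ennreal (2 * C * \<beta>V) = ennreal (2 * C) * ennreal \<beta>V"
        using C \<beta>(3) by (intro ennreal_mult) auto
      finally show ?thesis by (simp only: mult_1_left)
    qed
    finally have le: "ennreal \<beta>V * (\<integral>\<^sup>+x. tri_avg u v w f g h x \<partial>lborel) \<le> ennreal (\<beta>U + 2 * C * \<beta>V)" by simp
    have "ennreal (1 / \<beta>V) * ennreal \<beta>V = 1"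
      using \<beta>(3) by (subst ennreal_mult[symmetric]) auto
    then have "(\<integral>\<^sup>+x. tri_avg u v w f g h x \<partial>lborel) = ennreal (1 / \<beta>V) * (ennreal \<beta>V * (\<integral>\<^sup>+x. tri_avg u v w f g h x \<partial>lborel))"
      by (simp add: mult.assoc[symmetric])
    also have "\<dots> \<le> ennreal (1 / \<beta>V) * ennreal (\<beta>U + 2 * C * \<beta>V)"
      by (rule mult_left_mono[OF le]) simp
    also have "\<dots> = ennreal ((\<beta>U + 2 * C * \<beta>V) / \<beta>V)"
      using C \<beta>(3) by (subst ennreal_mult[symmetric]) (auto simp: \<beta>U_def)
    finally show ?thesis unfolding f_def g_def h_def .
  qed
  then show ?thesis unfolding L1_bounded_def by blast
qed

section \<open>Convexity of the set of exponents and the vertices\<close>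

lemma L1_bounded_convex_combination:
  assumes P0: "L1_bounded u v w (x0, y0, z0)" and P1: "L1_bounded u v w (x1, y1, z1)"
    and l: "0 < l" "0 < m" "l + m = 1"
  shows "L1_bounded u v w (l * x0 + m * x1, l * y0 + m * y1, l * z0 + m * z1)"
proof -
  obtain C0 where C0: "\<And>F G H. \<lbrakk>unit_mass F; unit_mass G; unit_mass H\<rbrakk> \<Longrightarrow>
     (\<integral>\<^sup>+t. tri_avg u v w (pw F x0) (pw G y0) (pw H z0) t \<partial>lborel) \<le> ennreal C0"
    using P0 unfolding L1_bounded_def by blast
  obtain C1 where C1: "\<And>F G H. \<lbrakk>unit_mass F; unit_mass G; unit_mass H\<rbrakk> \<Longrightarrow>
     (\<integral>\<^sup>+t. tri_avg u v w (pw F x1) (pw G y1) (pw H z1) t \<partial>lborel) \<le> ennreal C1"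
    using P1 unfolding L1_bounded_def by blast
  \<comment> \<open>\<open>C0\<close> and \<open>C1\<close> may be negative, as
    \<open>ennreal\<close> sends negative numbers to 0; the maxima make sums and products of
    constants pass through \<open>ennreal\<close>.\<close>
  have "(\<integral>\<^sup>+t. tri_avg u v w (pw F (l * x0 + m * x1)) (pw G (l * y0 + m * y1)) (pw H (l * z0 + m * z1)) t \<partial>lborel)
      \<le> ennreal (l * max C0 0 + m * max C1 0)"
    if FGH: "unit_mass F" "unit_mass G" "unit_mass H" for F G H
  proof -
    note [measurable] = FGH[THEN unit_massD(1)]
    let ?T0 = "tri_avg u v w (pw F x0) (pw G y0) (pw H z0)"
    let ?T1 = "tri_avg u v w (pw F x1) (pw G y1) (pw H z1)"
    have T: "tri_avg u v w (pw F (l * x0 + m * x1)) (pw G (l * y0 + m * y1)) (pw H (l * z0 + m * z1)) t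
        \<le> ennreal l * ?T0 t + ennreal m * ?T1 t" for t
    proof -
      have "tri_avg u v w (pw F (l * x0 + m * x1)) (pw G (l * y0 + m * y1)) (pw H (l * z0 + m * z1)) t \<le>
         (\<integral>\<^sup>+R. ennreal l * (pw F x0 (t - R *v u) * pw G y0 (t - R *v v) * pw H z0 (t - R *v w)) +
           ennreal m * (pw F x1 (t - R *v u) * pw G y1 (t - R *v v) * pw H z1 (t - R *v w)) \<partial>M)"
        unfolding tri_avg_def by (intro nn_integral_mono pw_convex_combination_le unit_massD(2) FGH l)
      also have "\<dots> = ennreal l * ?T0 t + ennreal m * ?T1 t"
        unfolding tri_avg_def by (simp add: nn_integral_add nn_integral_cmult)
      finally show ?thesis .
    qed
    have "(\<integral>\<^sup>+t. tri_avg u v w (pw F (l * x0 + m * x1)) (pw G (l * y0 + m * y1)) (pw H (l * z0 + m * z1)) t \<partial>lborel)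
      \<le> (\<integral>\<^sup>+t. ennreal l * ?T0 t + ennreal m * ?T1 t \<partial>lborel)"
      by (intro nn_integral_mono T)
    also have "\<dots> = ennreal l * (\<integral>\<^sup>+t. ?T0 t \<partial>lborel) + ennreal m * (\<integral>\<^sup>+t. ?T1 t \<partial>lborel)"
      by (simp add: nn_integral_add nn_integral_cmult)
    also have "\<dots> \<le> ennreal l * ennreal (max C0 0) + ennreal m * ennreal (max C1 0)"
      by (intro add_mono mult_left_mono order_trans[OF C0[OF FGH]] order_trans[OF C1[OF FGH]] ennreal_leI) simp_all
    also have "ennreal l * ennreal (max C0 0) = ennreal (l * max C0 0)"
      using l by (intro ennreal_mult[symmetric]) auto
    also have "ennreal m * ennreal (max C1 0) = ennreal (m * max C1 0)"
      using l by (intro ennreal_mult[symmetric]) auto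
    also have "ennreal (l * max C0 0) + ennreal (m * max C1 0) = ennreal (l * max C0 0 + m * max C1 0)"
      using l by (intro ennreal_plus[symmetric]) auto
    finally show ?thesis .
  qed
  then show ?thesis unfolding L1_bounded_def by blast
qed

lemma convex_L1_bounded: "convex {P. L1_bounded u v w P}"
proof (rule convexI)
  fix P Q l m
  assume PQ: "P \<in> {P. L1_bounded u v w P}" "Q \<in> {P. L1_bounded u v w P}" and l: "0 \<le> l" "0 \<le> m" "l + m = (1 :: real)"
  obtain x0 y0 z0 x1 y1 z1 where P: "P = (x0, y0, z0)" and Q: "Q = (x1, y1, z1)" by (metis prod.collapse)
  consider "l = 0" "m = 1" | "m = 0" "l = 1" | "0 < l" "0 < m" using l by linarith
  then show "l *\<^sub>R P + m *\<^sub>R Q \<in> {P. L1_bounded u v w P}"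
  proof cases
    case 3
    then show ?thesis
      using L1_bounded_convex_combination[of u v w x0 y0 z0 x1 y1 z1 l m] PQ l by (simp add: P Q)
  qed (use PQ in simp_all)
qed

lemma L1_bounded_diagonal:
  assumes uv: "norm (u - v) = 1" and a: "1/2 \<le> a" "a \<le> 5/8"
  shows "L1_bounded u v w (a, a, 0)"
proof -
  have vu: "norm (v - u) = 1" using uv by (simp add: norm_minus_commute)
  have A: "L1_bounded u v w (1/2, 3/4, 0)" by (rule L1_bounded_pair[OF uv])
  have B: "L1_bounded u v w (3/4, 1/2, 0)" by (rule L1_bounded_swap12[OF L1_bounded_pair[OF vu]])
  have five: "L1_bounded u v w (5/8, 5/8, 0)"
    using L1_bounded_convex_combination[OF A B, of "1/2" "1/2"] by simp
  moreover have half: "L1_bounded u v w (1/2, 1/2, 0)"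
    using L1_bounded_convex_combination[OF L1_bounded_100 L1_bounded_swap12[OF L1_bounded_100], of "1/2" "1/2"] by simp
  ultimately have "\<lbrakk>0 < l; 0 < m; l + m = 1\<rbrakk> \<Longrightarrow> L1_bounded u v w (l * (5/8) + m * (1/2), l * (5/8) + m * (1/2), 0)" for l m
    using L1_bounded_convex_combination[of u v w "5/8" "5/8" 0 "1/2" "1/2" 0 l m] by simp
  \<comment> \<open>The factor 8 is the inverse of the length 5/8 - 1/2 of the interval.\<close>
  note mid = this[of "(a - 1/2) * 8" "1 - (a - 1/2) * 8"]
  consider "a = 1/2" | "a = 5/8" | "1/2 < a" "a < 5/8" using a by linarith
  then show ?thesis
  proof cases
    case 3
    have "(a - 1/2) * 8 * (5/8) + (1 - (a - 1/2) * 8) * (1/2) = a" by (simp add: algebra_simps)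
    then show ?thesis using mid 3 by simp
  next
    case 1
    show ?thesis unfolding 1 by (rule half)
  next
    case 2
    show ?thesis unfolding 2 by (rule five)
  qed
qed

lemma convex_hull_vertices_subset:
  assumes uv: "norm (u - v) = 1" and vw: "norm (v - w) = 1" and wu: "norm (w - u) = 1"
    and a: "1/2 \<le> a" "a \<le> 5/8"
  shows "convex hull {(0, 1, 0), (1, 0, 0), (0, 0, 1), (1/2, 1/2, 1/2), (a, a, 0), (a, 0, a), (0, a, a)}
    \<subseteq> {P. L1_bounded u v w P}"
proof (rule hull_minimal)
  have uw: "norm (u - w) = 1" using wu by (simp add: norm_minus_commute)
  have "L1_bounded u v w (1, 0, 0)" "L1_bounded u v w (0, 1, 0)" "L1_bounded u v w (0, 0, 1)"
    using L1_bounded_100 L1_bounded_swap12[OF L1_bounded_100] L1_bounded_swap23[OF L1_bounded_swap12[OF L1_bounded_100]] by blast+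
  moreover have "L1_bounded u v w (1/2, 1/2, 1/2)" by (rule L1_bounded_half[OF uv vw wu])
  moreover have "L1_bounded u v w (a, a, 0)" by (rule L1_bounded_diagonal[OF uv a])
  moreover have "L1_bounded u v w (a, 0, a)" by (rule L1_bounded_swap23[OF L1_bounded_diagonal[OF uw a]])
  moreover have "L1_bounded u v w (0, a, a)"
    by (rule L1_bounded_swap12[OF L1_bounded_swap23[OF L1_bounded_diagonal[OF vw a]]])
  ultimately show "{(0, 1, 0), (1, 0, 0), (0, 0, 1), (1/2, 1/2, 1/2), (a, a, 0), (a, 0, a), (0, a, a)} \<subseteq> {P. L1_bounded u v w P}"
    by blast
qed (rule convex_L1_bounded)

end

section \<open>From \<open>L\<^sup>1\<close> to the Hoelder exponent\<close>

text \<open>The trilinear average may be infinite at some points, so powers with positive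
  \<open>r\<close> are taken on the extended half-line, in the same form as in
  \<open>Lp_norm\<close>.\<close>

definition epow :: "ennreal \<Rightarrow> real \<Rightarrow> ennreal" where
  "epow t r = (if t = \<infinity> then \<infinity> else ennreal (enn2real t powr r))"

lemma epow_measurable [measurable]:
  assumes [measurable]: "f \<in> borel_measurable N"
  shows "(\<lambda>x. epow (f x) r) \<in> borel_measurable N"
  unfolding epow_def by measurable

text \<open>Writing \<open>t\<close> as \<open>s powr \<sigma>\<close> times \<open>q\<close>, this
  is \<open>q powr (1 / \<sigma>) \<le> q + 1\<close>, which holds because
  \<open>1 / \<sigma> \<le> 1\<close>. It takes the place of Hoelder's inequality on a ball: the
  right side is linear in \<open>t\<close>, and \<open>s\<close> is a free scale.\<close>

lemma epow_le_linear:
  assumes s: "0 < s" and \<sigma>: "1 \<le> \<sigma>"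
  shows "epow t (1 / \<sigma>) \<le> ennreal s * (t * ennreal (s powr - \<sigma>) + 1)"
proof (cases t)
  case (real \<tau>)
  have "\<tau> powr (1 / \<sigma>) \<le> s * (\<tau> * s powr - \<sigma> + 1)"
  proof -
    define q where "q = \<tau> * s powr - \<sigma>"
    have q: "q \<ge> 0" using real by (simp add: q_def)
    have "q * s powr \<sigma> = \<tau>" using s by (simp add: q_def mult.assoc powr_add[symmetric])
    then have "\<tau> powr (1 / \<sigma>) = q powr (1 / \<sigma>) * (s powr \<sigma>) powr (1 / \<sigma>)"
      using q by (metis powr_ge_zero powr_mult)
    also have "(s powr \<sigma>) powr (1 / \<sigma>) = s" using s \<sigma> by (simp add: powr_powr)
    also have "q powr (1 / \<sigma>) \<le> q + 1"
    proof (cases "q \<le> 1")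
      case True
      then have "q powr (1 / \<sigma>) \<le> 1" using q \<sigma> by (intro powr_le1) auto
      then show ?thesis using q by simp
    next
      case False
      then have "q powr (1 / \<sigma>) \<le> q powr 1" using \<sigma> by (intro powr_mono) auto
      then show ?thesis using False by simp
    qed
    finally show ?thesis using s by (simp add: q_def mult.commute)
  qed
  then have "ennreal (\<tau> powr (1 / \<sigma>)) \<le> ennreal (s * (\<tau> * s powr - \<sigma> + 1))" by (rule ennreal_leI)
  also have "ennreal (s * (\<tau> * s powr - \<sigma> + 1)) = ennreal s * ennreal (\<tau> * s powr - \<sigma> + 1)"
    using s by (intro ennreal_mult') simp
  also have "ennreal (\<tau> * s powr - \<sigma> + 1) = ennreal (\<tau> * s powr - \<sigma>) + ennreal 1"
    using real by (intro ennreal_plus) auto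
  also have "ennreal (\<tau> * s powr - \<sigma>) = ennreal \<tau> * ennreal (s powr - \<sigma>)"
    using real by (intro ennreal_mult') simp
  finally show ?thesis using real by (simp add: epow_def)
next
  case top
  have "ennreal (s powr - \<sigma>) \<noteq> 0" "ennreal s \<noteq> 0" using s by (simp_all add: powr_gt_zero not_le)
  then have "ennreal s * (t * ennreal (s powr - \<sigma>) + 1) = \<infinity>"
    by (simp add: top ennreal_top_mult ennreal_mult_top)
  then show ?thesis by simp
qed

text \<open>The scale in \<open>epow_le_linear\<close> has to be positive, whereas the mass near a
  point may be 0. The local bound is therefore proved for every larger scale and carried to the
  limit.\<close>

lemma ennreal_le_mult_of_greater:
  fixes X :: ennreal and S K :: real
  assumes "0 \<le> S" and "0 \<le> K" and le: "\<And>s. S < s \<Longrightarrow> X \<le> ennreal (s * K)"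
  shows "X \<le> ennreal (S * K)"
proof (rule ennreal_le_epsilon)
  fix e :: real assume e: "0 < e"
  have "X \<le> ennreal ((S + e / (K + 1)) * K)"
    using e assms(2) by (intro le) simp
  also have "(S + e / (K + 1)) * K \<le> S * K + e"
    using e assms(2) by (simp add: field_simps)
  then have "ennreal ((S + e / (K + 1)) * K) \<le> ennreal (S * K + e)" by (rule ennreal_leI)
  also have "\<dots> = ennreal (S * K) + ennreal e" using assms e by (simp add: ennreal_plus)
  finally show "X \<le> ennreal (S * K) + ennreal e" .
qed

context rotation_average
begin

text \<open>The operator is local. On a unit ball around \<open>c\<close> only the masses in \<open>ball c 2\<close> matter, and
  with \<open>s\<close> their sum and \<open>\<sigma> = x + y + z\<close>, \<open>T powr (1/\<sigma>) \<le> s (T / s powr \<sigma> + 1)\<close>. Integrate over \<open>c\<close>.\<close>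

lemma epow_tri_avg_bounded:
  assumes nu: "norm u = 1" "norm v = 1" "norm w = 1"
    and \<sigma>: "1 \<le> x + y + z" and L: "L1_bounded u v w (x, y, z)"
  obtains C :: real where "C \<ge> 0" and "\<And>F G H. \<lbrakk>unit_mass F; unit_mass G; unit_mass H\<rbrakk> \<Longrightarrow>
    (\<integral>\<^sup>+t. epow (tri_avg u v w (pw F x) (pw G y) (pw H z) t) (1 / (x + y + z)) \<partial>lborel) \<le> ennreal C"
proof -
  define \<sigma> where "\<sigma> = x + y + z"
  obtain C0 where "\<And>F G H. \<lbrakk>unit_mass F; unit_mass G; unit_mass H\<rbrakk> \<Longrightarrow>
     (\<integral>\<^sup>+t. tri_avg u v w (pw F x) (pw G y) (pw H z) t \<partial>lborel) \<le> ennreal C0"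
    using L unfolding L1_bounded_def by blast
  moreover define C where "C = max C0 0"
  ultimately have C: "\<And>F G H. \<lbrakk>unit_mass F; unit_mass G; unit_mass H\<rbrakk> \<Longrightarrow>
     (\<integral>\<^sup>+t. tri_avg u v w (pw F x) (pw G y) (pw H z) t \<partial>lborel) \<le> ennreal C" and C0: "C \<ge> 0"
    by (auto simp: max_def ennreal_neg)
  define B1 B2 :: "(real ^ 'n) set" where "B1 = ball 0 1" and "B2 = ball 0 2"
  have [measurable]: "B1 \<in> sets borel" "B2 \<in> sets borel" by (simp_all add: B1_def B2_def)
  define \<beta>1 \<beta>2 where "\<beta>1 = measure lborel B1" and "\<beta>2 = measure lborel B2"
  have \<beta>: "emeasure lborel B1 = ennreal \<beta>1" "emeasure lborel B2 = ennreal \<beta>2" "\<beta>1 > 0" "\<beta>2 > 0"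
    by (simp_all add: \<beta>1_def \<beta>2_def B1_def B2_def emeasure_ball content_ball)
  have shift: "(\<integral>\<^sup>+c. indicator A (t - c) \<partial>lborel) = emeasure lborel A"
    "(\<integral>\<^sup>+c. indicator A (c - t) \<partial>lborel) = emeasure lborel A" if [measurable]: "A \<in> sets borel" for A and t :: "real ^ 'n"
    using nn_integral_lborel_reflect[of "indicator A" t] nn_integral_lborel_shift[of "indicator A" "- t"] by simp_all
  \<comment> \<open>\<open>C\<close> bounds the integral of the rescaled form, and
    \<open>\<beta>1\<close> is the integral over a unit ball of the summand 1 in
    \<open>epow_le_linear\<close>.\<close>
  define K where "K = C + \<beta>1"
  have K: "K \<ge> 0" using C0 \<beta> by (simp add: K_def)
  have "(\<integral>\<^sup>+t. epow (tri_avg u v w (pw F x) (pw G y) (pw H z) t) (1 / \<sigma>) \<partial>lborel) \<le> ennreal (1 / \<beta>1 * (K * (\<beta>2 * 3)))"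
    if FGH: "unit_mass F" "unit_mass G" "unit_mass H" for F G H
  proof -
    note Fm[measurable] = FGH[THEN unit_massD(1)]
    define T where "T = tri_avg u v w (pw F x) (pw G y) (pw H z)"
    have Tm[measurable]: "T \<in> borel_measurable borel" unfolding T_def by measurable
    define mass where "mass F c = (\<integral>\<^sup>+t. pw F 1 t * indicator B2 (t - c) \<partial>lborel)" for F and c :: "real ^ 'n"
    define S where "S c = mass F c + mass G c + mass H c" for c
    have mass1: "mass F' c \<le> 1" if "unit_mass F'" for F' c
      unfolding mass_def using unit_massD(3)[OF that]
      by (rule order_trans[rotated]) (auto intro!: nn_integral_mono simp: indicator_def)
    \<comment> \<open>The exponent \<open>1 / \<sigma>\<close> makes the left side homogeneous of
      degree 1 when all three functions are scaled together, so the bound is linear in the local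
      mass \<open>S c\<close> and can be integrated over \<open>c\<close>.\<close>
    have local: "(\<integral>\<^sup>+t. indicator B1 (t - c) * epow (T t) (1 / \<sigma>) \<partial>lborel) \<le> ennreal K * S c" for c
    proof -
      have "S c \<le> 1 + 1 + 1" unfolding S_def by (intro add_mono mass1 FGH)
      then have "S c < \<infinity>" using le_less_trans by fastforce
      then obtain S' where S': "S c = ennreal S'" "S' \<ge> 0" by (cases "S c") auto
      have bnd: "(\<integral>\<^sup>+t. indicator B1 (t - c) * epow (T t) (1 / \<sigma>) \<partial>lborel) \<le> ennreal (s * K)" if s: "S' < s" for s
      proof -
        have s0: "s > 0" using s S' by simp
        \<comment> \<open>Each function is cut off to the ball of radius 2 around \<open>c\<close>
          and divided by the common scale \<open>s\<close>, which exceeds all three local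
          masses.\<close>
        define loc where "loc F t = F t * indicator B2 (t - c) / s" for F :: "real ^ 'n \<Rightarrow> real" and t
        have dens: "unit_mass (loc F')" if F': "unit_mass F'" and le: "mass F' c \<le> S c" for F'
        proof -
          note [measurable] = unit_massD(1)[OF F']
          have "(\<integral>\<^sup>+t. ennreal (loc F' t) \<partial>lborel) = (\<integral>\<^sup>+t. ennreal (1 / s) * (pw F' 1 t * indicator B2 (t - c)) \<partial>lborel)"
            using unit_massD(2)[OF F'] s0
            by (intro nn_integral_cong) (auto simp: loc_def pw_1 indicator_def ennreal_mult[symmetric])
          also have "\<dots> = ennreal (1 / s) * mass F' c"
            unfolding mass_def by (rule nn_integral_cmult) measurable
          also have "\<dots> \<le> ennreal (1 / s) * ennreal s"
            using le S' s by (intro mult_left_mono) (auto intro: order_trans ennreal_leI)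
          also have "\<dots> = 1" using s0 by (simp add: ennreal_mult[symmetric])
          finally show ?thesis
            using unit_massD(2)[OF F'] s0 unfolding unit_mass_def loc_def by simp
        qed
        have "mass F c \<le> S c" "mass G c \<le> S c" "mass H c \<le> S c"
          by (simp_all add: S_def add_increasing add_increasing2)
        note D = dens[OF FGH(1) this(1)] dens[OF FGH(2) this(2)] dens[OF FGH(3) this(3)]
        note [measurable] = D[THEN unit_massD(1)]
        define T' where "T' = tri_avg u v w (pw (loc F) x) (pw (loc G) y) (pw (loc H) z)"
        have T'm[measurable]: "T' \<in> borel_measurable borel" unfolding T'_def by measurable
        \<comment> \<open>The vectors \<open>u\<close>, \<open>v\<close>, \<open>w\<close> have
          length 1, so for \<open>t\<close> within 1 of \<open>c\<close> every argument lies within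
          2 of \<open>c\<close>, where the cut-off has no effect.\<close>
        have scale: "T t = ennreal (s powr \<sigma>) * T' t" if t: "t - c \<in> B1" for t
        proof -
          have e: "pw F' e (t - R *v q) = ennreal (s powr e) * pw (loc F') e (t - R *v q)"
            if "unit_mass F'" "rotation_matrix R" "norm q = 1" for F' e R q
          proof -
            have "norm (t - R *v q - c) < 2"
              using norm_triangle_ineq4[of "t - c" "R *v q"] t rotation_matrix_norm[OF that(2), of q] that(3)
              by (simp add: B1_def algebra_simps)
            then have "F' (t - R *v q) = s * loc F' (t - R *v q)" "loc F' (t - R *v q) \<ge> 0"
              using s0 unit_massD(2)[OF that(1)] by (simp_all add: loc_def B2_def)
            then show ?thesis using s0 by (simp add: pw_def powr_mult ennreal_mult)
          qed
          have c3: "ennreal (s powr x) * ennreal (s powr y) * ennreal (s powr z) = ennreal (s powr \<sigma>)"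
            using s0 by (simp only: \<sigma>_def powr_add ennreal_mult powr_ge_zero mult_nonneg_nonneg)
          have ac: "(a1 * b1) * (a2 * b2) * (a3 * b3) = (a1 * a2 * a3) * (b1 * b2 * b3)" for a1 a2 a3 b1 b2 b3 :: ennreal
            by (simp add: mult_ac)
          have "T t = (\<integral>\<^sup>+R. ennreal (s powr \<sigma>) * (pw (loc F) x (t - R *v u) * pw (loc G) y (t - R *v v) * pw (loc H) z (t - R *v w)) \<partial>M)"
            unfolding T_def tri_avg_def
            by (rule nn_integral_cong_AE, use AE_rotation in eventually_elim)
              (simp only: e[OF FGH(1) _ nu(1)] e[OF FGH(2) _ nu(2)] e[OF FGH(3) _ nu(3)] ac c3)
          also have "\<dots> = ennreal (s powr \<sigma>) * T' t"
            unfolding T'_def tri_avg_def by (rule nn_integral_cmult) measurable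
          finally show ?thesis .
        qed
        have "(\<integral>\<^sup>+t. indicator B1 (t - c) * epow (T t) (1 / \<sigma>) \<partial>lborel)
          \<le> (\<integral>\<^sup>+t. ennreal s * (T' t + indicator B1 (t - c)) \<partial>lborel)"
        proof (intro nn_integral_mono)
          fix t
          show "indicator B1 (t - c) * epow (T t) (1 / \<sigma>) \<le> ennreal s * (T' t + indicator B1 (t - c))"
          proof (cases "t - c \<in> B1")
            case True
            have inv: "ennreal (s powr \<sigma>) * ennreal (s powr - \<sigma>) = 1"
              using s0 by (simp add: ennreal_mult[symmetric] powr_add[symmetric])
            have ac: "p * q * r = q * (p * r)" for p q r :: ennreal by (simp add: mult_ac)
            have "T t * ennreal (s powr - \<sigma>) = T' t"
              unfolding scale[OF True] ac[of "ennreal (s powr \<sigma>)"] inv by simp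
            moreover have "epow (T t) (1 / \<sigma>) \<le> ennreal s * (T t * ennreal (s powr - \<sigma>) + 1)"
              by (rule epow_le_linear[OF s0]) (use assms(4) in \<open>simp add: \<sigma>_def\<close>)
            moreover have "indicator B1 (t - c) = (1 :: ennreal)" using True by simp
            ultimately show ?thesis by (simp only: mult_1_left)
          qed simp
        qed
        also have "\<dots> = ennreal s * ((\<integral>\<^sup>+t. T' t \<partial>lborel) + ennreal \<beta>1)"
        proof -
          have e1: "(\<integral>\<^sup>+t. ennreal s * (T' t + indicator B1 (t - c)) \<partial>lborel) =
              ennreal s * (\<integral>\<^sup>+t. T' t + indicator B1 (t - c) \<partial>lborel)"
            by (rule nn_integral_cmult) measurable
          have e2: "(\<integral>\<^sup>+t. T' t + indicator B1 (t - c) \<partial>lborel) =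
              (\<integral>\<^sup>+t. T' t \<partial>lborel) + (\<integral>\<^sup>+t. indicator B1 (t - c) \<partial>lborel)"
            by (rule nn_integral_add) measurable
          have e3: "(\<integral>\<^sup>+t. indicator B1 (t - c) \<partial>lborel) = ennreal \<beta>1"
            unfolding \<beta>(1)[symmetric] by (rule shift(2)) measurable
          show ?thesis by (simp only: e1 e2 e3)
        qed
        also have "\<dots> \<le> ennreal s * (ennreal C + ennreal \<beta>1)"
          unfolding T'_def by (rule mult_left_mono[OF add_right_mono[OF C[OF D]]]) (rule zero_le)
        also have "\<dots> = ennreal (s * K)"
        proof -
          have "ennreal C + ennreal \<beta>1 = ennreal K"
            unfolding K_def using C0 \<beta> by (intro ennreal_plus[symmetric]) auto
          then show ?thesis using s0 ennreal_mult'[of s K] by simp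
        qed
        finally show ?thesis .
      qed
      have "ennreal (S' * K) = ennreal K * S c"
        using S' K ennreal_mult[of S' K] by (simp only: mult.commute)
      then show ?thesis using ennreal_le_mult_of_greater[OF S'(2) K bnd] by (simp only:)
    qed
    have massm[measurable]: "mass F' \<in> borel_measurable borel" if [measurable]: "F' \<in> borel_measurable borel" for F'
      unfolding mass_def by measurable
    have massI: "(\<integral>\<^sup>+c. mass F' c \<partial>lborel) \<le> ennreal \<beta>2" if F': "unit_mass F'" for F'
    proof -
      note [measurable] = unit_massD(1)[OF F']
      have "(\<integral>\<^sup>+c. mass F' c \<partial>lborel) = (\<integral>\<^sup>+t. \<integral>\<^sup>+c. pw F' 1 t * indicator B2 (t - c) \<partial>lborel \<partial>lborel)"
        unfolding mass_def by (rule lborel_Fubini) measurable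
      also have "\<dots> = (\<integral>\<^sup>+t. pw F' 1 t \<partial>lborel) * ennreal \<beta>2"
        by (simp add: nn_integral_cmult nn_integral_multc shift \<beta>)
      also have "\<dots> \<le> 1 * ennreal \<beta>2"
        by (intro mult_right_mono unit_massD(3)[OF F']) simp
      finally show ?thesis by simp
    qed
    \<comment> \<open>Every \<open>t\<close> is within 1 of a set of centres of volume
      \<open>\<beta>1\<close>, and each of the three functions is counted with weight
      \<open>\<beta>2\<close>; hence the factor \<open>\<beta>2 * 3\<close> divided by
      \<open>\<beta>1\<close>.\<close>
    have "ennreal \<beta>1 * (\<integral>\<^sup>+t. epow (T t) (1 / \<sigma>) \<partial>lborel) =
        (\<integral>\<^sup>+t. \<integral>\<^sup>+c. indicator B1 (t - c) * epow (T t) (1 / \<sigma>) \<partial>lborel \<partial>lborel)"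
      by (simp add: nn_integral_multc shift \<beta> nn_integral_cmult)
    also have "\<dots> = (\<integral>\<^sup>+c. \<integral>\<^sup>+t. indicator B1 (t - c) * epow (T t) (1 / \<sigma>) \<partial>lborel \<partial>lborel)"
      by (rule lborel_Fubini) measurable
    also have "\<dots> \<le> (\<integral>\<^sup>+c. ennreal K * S c \<partial>lborel)"
      by (intro nn_integral_mono local)
    also have "\<dots> = ennreal K * ((\<integral>\<^sup>+c. mass F c \<partial>lborel) + (\<integral>\<^sup>+c. mass G c \<partial>lborel) + (\<integral>\<^sup>+c. mass H c \<partial>lborel))"
      unfolding S_def by (simp add: nn_integral_cmult nn_integral_add)
    also have "\<dots> \<le> ennreal K * (ennreal \<beta>2 + ennreal \<beta>2 + ennreal \<beta>2)"
      by (intro mult_left_mono add_mono massI FGH) simp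
    also have "\<dots> = ennreal (K * (\<beta>2 * 3))"
    proof -
      have "ennreal \<beta>2 + ennreal \<beta>2 + ennreal \<beta>2 = ennreal (\<beta>2 + \<beta>2 + \<beta>2)"
        using \<beta>(4) ennreal_plus[of \<beta>2 \<beta>2] ennreal_plus[of "\<beta>2 + \<beta>2" \<beta>2]
        by (metis add_nonneg_nonneg less_imp_le)
      moreover have "\<beta>2 + \<beta>2 + \<beta>2 = \<beta>2 * 3" by simp
      moreover have "ennreal (K * (\<beta>2 * 3)) = ennreal K * ennreal (\<beta>2 * 3)"
        using K \<beta>(4) by (intro ennreal_mult) auto
      ultimately show ?thesis by (simp only:)
    qed
    finally have le: "ennreal \<beta>1 * (\<integral>\<^sup>+t. epow (T t) (1 / \<sigma>) \<partial>lborel) \<le> ennreal (K * (\<beta>2 * 3))" .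
    have "ennreal (1 / \<beta>1) * ennreal \<beta>1 = 1"
      using \<beta>(3) by (subst ennreal_mult[symmetric]) auto
    then have "(\<integral>\<^sup>+t. epow (T t) (1 / \<sigma>) \<partial>lborel) = ennreal (1 / \<beta>1) * (ennreal \<beta>1 * (\<integral>\<^sup>+t. epow (T t) (1 / \<sigma>) \<partial>lborel))"
      by (simp add: mult.assoc[symmetric])
    also have "\<dots> \<le> ennreal (1 / \<beta>1) * ennreal (K * (\<beta>2 * 3))"
      by (rule mult_left_mono[OF le]) simp
    also have "\<dots> = ennreal (1 / \<beta>1 * (K * (\<beta>2 * 3)))"
      using \<beta> K by (intro ennreal_mult[symmetric]) auto
    finally show ?thesis unfolding T_def .
  qed
  moreover have "1 / \<beta>1 * (K * (\<beta>2 * 3)) \<ge> 0" using \<beta> K by simp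
  ultimately show ?thesis using that unfolding \<sigma>_def by blast
qed

end

section \<open>The pyramid averaging operator\<close>

lemma boundedness_vertices_eq:
  assumes "a = (3 * d - 2) / (5 * d)"
  shows "boundedness_vertices d = {(0, 1, 0), (1, 0, 0), (0, 0, 1), (1/2, 1/2, 1/2), (a, a, 0), (a, 0, a), (0, a, a)}"
  unfolding assms boundedness_vertices_def Let_def by simp

text \<open>A linear inequality that holds at all vertices is strict in the interior of the hull.
  For the sum of the coordinates this needs \<open>2 * a \<ge> 1\<close> at vertices such as (a, a,
  0), that is, \<open>d \<ge> 4\<close>.\<close>

lemma Conv_boundedness_vertices:
  assumes d: "4 \<le> d" and P: "(x, y, z) \<in> Conv (boundedness_vertices d)"
  shows "0 < x" "0 < y" "0 < z" "1 \<le> x + y + z"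
proof -
  define a where "a = (3 * d - 2) / (5 * d)"
  have a: "1/2 \<le> a" using d by (simp add: a_def field_simps)
  let ?V = "{(0, 1, 0), (1, 0, 0), (0, 0, 1), (1/2, 1/2, 1/2), (a, a, 0), (a, 0, a), (0, a, a)} :: (real \<times> real \<times> real) set"
  have V: "boundedness_vertices d = ?V" by (rule boundedness_vertices_eq[OF a_def])
  have P': "(x, y, z) \<in> interior (convex hull ?V)" using P by (simp add: Conv_def V)
  have half: "c \<bullet> (x, y, z) > k" if "c \<noteq> 0" and "\<And>p. p \<in> ?V \<Longrightarrow> c \<bullet> p \<ge> k" for c :: "real \<times> real \<times> real" and k
  proof -
    have "convex hull ?V \<subseteq> {p. c \<bullet> p \<ge> k}"
      by (rule hull_minimal) (use that(2) convex_halfspace_ge in auto)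
    then have "interior (convex hull ?V) \<subseteq> {p. c \<bullet> p > k}"
      using interior_mono interior_halfspace_ge[OF that(1)] by metis
    then show ?thesis using P' by auto
  qed
  have "(1, 0, 0) \<bullet> (x, y, z) > 0" by (rule half) (use a in \<open>auto simp: zero_prod_def\<close>)
  then show "0 < x" by simp
  have "(0, 1, 0) \<bullet> (x, y, z) > 0" by (rule half) (use a in \<open>auto simp: zero_prod_def\<close>)
  then show "0 < y" by simp
  have "(0, 0, 1) \<bullet> (x, y, z) > 0" by (rule half) (use a in \<open>auto simp: zero_prod_def\<close>)
  then show "0 < z" by simp
  have "(1, 1, 1) \<bullet> (x, y, z) > 1" by (rule half) (use a in \<open>auto simp: zero_prod_def\<close>)
  then show "1 \<le> x + y + z" by simp
qed

text \<open>If \<open>f\<close> is not integrable, its Bochner integral is 0 by convention and the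
  bound is trivial.\<close>

lemma ennreal_norm_integral_le:
  fixes f :: "'a \<Rightarrow> 'b::{banach, second_countable_topology}"
  assumes "f \<in> borel_measurable N"
  shows "ennreal (norm (integral\<^sup>L N f)) \<le> (\<integral>\<^sup>+x. ennreal (norm (f x)) \<partial>N)"
proof (cases "integrable N f")
  case True
  then show ?thesis by (rule integral_norm_bound_ennreal)
qed (simp add: not_integrable_integral_eq)

text \<open>Nonempty open sets have positive measure. Vanishing everywhere, and not only almost
  everywhere, makes the pyramid operator vanish at every point.\<close>

lemma continuous_nn_integral_powr_eq_0:
  fixes f :: "'a::euclidean_space \<Rightarrow> complex"
  assumes f: "continuous_on UNIV f" and I: "(\<integral>\<^sup>+x. ennreal (norm (f x) powr p) \<partial>lborel) = 0"
  shows "f x = 0"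
proof (rule ccontr)
  assume "f x \<noteq> 0"
  define U where "U = {y. f y \<noteq> 0}"
  have "open U" unfolding U_def by (intro open_Collect_neq f continuous_on_const)
  moreover have "x \<in> U" using \<open>f x \<noteq> 0\<close> by (simp add: U_def)
  ultimately have "\<not> negligible U" using open_not_negligible by blast
  have [measurable]: "f \<in> borel_measurable borel" by (rule borel_measurable_continuous_onI[OF f])
  have "AE y in lborel. ennreal (norm (f y) powr p) = 0"
    using I by (subst (asm) nn_integral_0_iff_AE) auto
  then have "AE y in lborel. y \<notin> U" by eventually_elim (auto simp: U_def not_less)
  then have "U \<in> null_sets lborel"
    using \<open>open U\<close> AE_iff_null_sets[of U lborel] by auto
  then show False using \<open>\<not> negligible U\<close>
    by (simp add: negligible_iff_null_sets null_sets_completionI)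
qed

section \<open>Averages over the Haar measure\<close>

lemma matrix_mult_measurable:
  fixes Q :: "real ^ 'n::finite ^ 'n"
  shows "(\<lambda>R. Q ** R) \<in> borel_measurable borel"
  by (rule borel_measurable_continuous_onI) (simp add: matrix_matrix_mult_def, intro continuous_intros)

text \<open>Invariance is assumed for images of sets, while a change of variables needs preimages.
  The preimage of \<open>A\<close> under multiplication by \<open>Q\<close> is its image under
  multiplication by \<open>transpose Q\<close>.\<close>

lemma haar_nn_integral_left_invariant:
  fixes H :: "(real ^ 'n ^ 'n::finite) measure"
  assumes H: "haar_prob_SO H" and Q: "rotation_matrix Q" and \<phi>: "\<phi> \<in> borel_measurable H"
  shows "(\<integral>\<^sup>+R. \<phi> (Q ** R) \<partial>H) = (\<integral>\<^sup>+R. \<phi> R \<partial>H)"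
proof -
  have sH: "sets H = sets (restrict_space borel SO)"
    and inv: "\<And>R A. \<lbrakk>R \<in> SO; A \<in> sets H\<rbrakk> \<Longrightarrow> emeasure H ((\<lambda>Q. R ** Q) ` A) = emeasure H A"
    using H by (auto simp: haar_prob_SO_def)
  have sp: "space H = SO" using sets_eq_imp_space_eq[OF sH] by (simp add: space_restrict_space)
  have mul: "rotation_matrix (A ** B)" if "rotation_matrix A" "rotation_matrix B" for A B :: "real ^ 'n ^ 'n"
    using that by (simp add: rotation_matrix_def orthogonal_matrix_mul det_mul)
  have QQ: "transpose Q ** Q = mat 1" "Q ** transpose Q = mat 1"
    using Q by (simp_all add: rotation_matrix_def orthogonal_matrix_def)
  have "(\<lambda>R. Q ** R) \<in> restrict_space borel SO \<rightarrow>\<^sub>M restrict_space borel SO"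
    using mul[OF Q] by (intro measurable_restrict_space3 matrix_mult_measurable) (auto simp: SO_def)
  then have m: "(\<lambda>R. Q ** R) \<in> H \<rightarrow>\<^sub>M H"
    by (simp add: sH cong: measurable_cong_sets)
  have "distr H H (\<lambda>R. Q ** R) = H"
  proof (rule measure_eqI)
    fix A assume "A \<in> sets (distr H H (\<lambda>R. Q ** R))"
    then have A: "A \<in> sets H" by simp
    then have ASO: "A \<subseteq> SO" using sets.sets_into_space sp by blast
    have "(\<lambda>R. Q ** R) -` A \<inter> space H = (\<lambda>R. transpose Q ** R) ` A"
    proof (intro equalityI subsetI)
      fix R assume "R \<in> (\<lambda>R. Q ** R) -` A \<inter> space H"
      moreover have "R = transpose Q ** (Q ** R)" by (simp add: matrix_mul_assoc QQ)
      ultimately show "R \<in> (\<lambda>R. transpose Q ** R) ` A" by blast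
    next
      fix R' assume "R' \<in> (\<lambda>R. transpose Q ** R) ` A"
      then obtain R where R: "R \<in> A" "R' = transpose Q ** R" by blast
      then have "Q ** R' \<in> A" by (simp add: matrix_mul_assoc QQ)
      moreover have "R' \<in> space H"
        using R ASO mul[OF rotation_matrix_transpose[OF Q]] by (auto simp: sp SO_def)
      ultimately show "R' \<in> (\<lambda>R. Q ** R) -` A \<inter> space H" by blast
    qed
    then show "emeasure (distr H H (\<lambda>R. Q ** R)) A = emeasure H A"
      using inv[of "transpose Q", OF _ A] rotation_matrix_transpose[OF Q] A m by (simp add: emeasure_distr SO_def)
  qed simp
  then have "(\<integral>\<^sup>+R. \<phi> R \<partial>H) = (\<integral>\<^sup>+R. \<phi> R \<partial>distr H H (\<lambda>R. Q ** R))" by simp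
  also have "\<dots> = (\<integral>\<^sup>+R. \<phi> (Q ** R) \<partial>H)" by (subst nn_integral_distr) (use m \<phi> in simp_all)
  finally show ?thesis by simp
qed

lemma haar_id_measurable:
  assumes "haar_prob_SO H"
  shows "(\<lambda>R. R) \<in> H \<rightarrow>\<^sub>M borel"
proof -
  have "(\<lambda>R. R) \<in> restrict_space borel SO \<rightarrow>\<^sub>M borel" by (rule measurable_restrict_space1) simp
  then show ?thesis using assms by (simp add: haar_prob_SO_def cong: measurable_cong_sets)
qed

lemma rotation_average_haar:
  fixes H :: "(real ^ 'n ^ 'n::finite) measure"
  assumes H: "haar_prob_SO H" and n: "3 \<le> CARD('n)"
  shows "rotation_average (distr H borel (\<lambda>R. R))"
proof (rule rotation_average.intro)
  have sH: "sets H = sets (restrict_space borel SO)" and pH: "prob_space H"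
    using H by (auto simp: haar_prob_SO_def)
  have sp: "space H = SO" using sets_eq_imp_space_eq[OF sH] by (simp add: space_restrict_space)
  note id = haar_id_measurable[OF H]
  show "sets (distr H borel (\<lambda>R. R)) = sets borel" by simp
  show "prob_space (distr H borel (\<lambda>R. R))" by (rule prob_space.prob_space_distr[OF pH id])
  \<comment> \<open>The rotations are cut out by polynomial equations in the entries, hence
    closed.\<close>
  have [measurable]: "{R :: real ^ 'n ^ 'n. rotation_matrix R} \<in> sets borel"
  proof (rule borel_closed)
    have "{R :: real ^ 'n ^ 'n. rotation_matrix R} = {R. transpose R ** R = mat 1} \<inter> {R. det R = 1}"
      by (auto simp: rotation_matrix_def orthogonal_matrix)
    also have "closed \<dots>"
      by (intro closed_Int closed_Collect_eq continuous_on_const)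
        (simp_all add: matrix_matrix_mult_def transpose_def det_def, (intro continuous_intros)+)
    finally show "closed {R :: real ^ 'n ^ 'n. rotation_matrix R}" .
  qed
  show "AE R in distr H borel (\<lambda>R. R). rotation_matrix R"
    by (subst AE_distr_iff[OF id]) (auto simp: sp SO_def)
  show "(\<integral>\<^sup>+R. \<phi> (Q ** R) \<partial>distr H borel (\<lambda>R. R)) = (\<integral>\<^sup>+R. \<phi> R \<partial>distr H borel (\<lambda>R. R))"
    if Q: "rotation_matrix Q" and \<phi>: "\<phi> \<in> borel_measurable borel" for Q \<phi>
  proof -
    have "(\<lambda>R. \<phi> (Q ** R)) \<in> borel_measurable borel"
      by (rule measurable_compose[OF matrix_mult_measurable \<phi>])
    then show ?thesis
      using haar_nn_integral_left_invariant[OF H Q measurable_compose[OF id \<phi>]] id \<phi>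
      by (simp add: nn_integral_distr)
  qed
  show "3 \<le> CARD('n)" by (rule n)
qed

section \<open>The operator on Schwartz functions\<close>

lemma schwartz_continuous: "f \<in> schwartz \<Longrightarrow> continuous_on UNIV f"
proof -
  assume "f \<in> schwartz"
  then have "f differentiable (at x)" for x
    unfolding schwartz_def by (auto dest: spec[of _ "[]"])
  then show ?thesis
    by (meson continuous_at_imp_continuous_on differentiable_imp_continuous_within)
qed

text \<open>The only inequality is the one for the absolute value of an integral; the remaining
  steps carry the surface measure over to the Haar measure and then to all matrices.\<close>

lemma pyramid_op_le_tri_avg:
  fixes H :: "(real ^ 'n ^ 'n::finite) measure"
  assumes b: "inj_on b {1, 2, 3}" and H: "haar_prob_SO H" and n: "3 \<le> CARD('n)"
    and fm: "f \<in> borel_measurable borel" and gm: "g \<in> borel_measurable borel" and hm: "h \<in> borel_measurable borel"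
    and uvw: "u = axis (b 1) 1" "v = (1 / 2) *\<^sub>R axis (b 1) 1 + (sqrt 3 / 2) *\<^sub>R axis (b 2) 1"
    "w = (1 / 2) *\<^sub>R axis (b 1) 1 + (1 / (2 * sqrt 3)) *\<^sub>R axis (b 2) 1 + (sqrt 2 / sqrt 3) *\<^sub>R axis (b 3) (1 :: real)"
  shows "ennreal (norm (pyramid_op H b f g h x)) \<le> rotation_average.tri_avg (distr H borel (\<lambda>R. R)) u v w
    (\<lambda>t. ennreal (norm (f t))) (\<lambda>t. ennreal (norm (g t))) (\<lambda>t. ennreal (norm (h t))) x"
proof -
  interpret rotation_average "distr H borel (\<lambda>R. R)" by (rule rotation_average_haar[OF H n])
  note [measurable] = fm gm hm
  have rp: "rotated_pyramid b R = (R *v u, R *v v, R *v w)" for R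
    by (simp add: rotated_pyramid_def uvw Let_def)
  define \<Phi> where "\<Phi> = (\<lambda>(u, v, w). f (x - u) * g (x - v) * h (x - w))"
  have \<Phi>: "\<Phi> \<in> borel_measurable borel"
    unfolding \<Phi>_def borel_prod[symmetric] by measurable
  have "pyramid_op H b f g h x = (\<integral>R. \<Phi> (rotated_pyramid b R) \<partial>H)"
    unfolding pyramid_op_def \<Phi>_def[symmetric]
    by (rule integral_pyramid_measure[OF b H measurable_restrict_space1[OF \<Phi>]])
  also have "ennreal (norm \<dots>) \<le> (\<integral>\<^sup>+R. ennreal (norm (\<Phi> (rotated_pyramid b R))) \<partial>H)"
    by (intro ennreal_norm_integral_le measurable_compose[OF measurable_rotated_pyramid[OF b H]] measurable_restrict_space1 \<Phi>)
  also have "\<dots> = (\<integral>\<^sup>+R. ennreal (norm (f (x - R *v u))) * ennreal (norm (g (x - R *v v))) * ennreal (norm (h (x - R *v w))) \<partial>H)"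
    by (simp add: rp \<Phi>_def norm_mult ennreal_mult)
  also have "\<dots> = tri_avg u v w (\<lambda>t. ennreal (norm (f t))) (\<lambda>t. ennreal (norm (g t))) (\<lambda>t. ennreal (norm (h t))) x"
    unfolding tri_avg_def by (subst nn_integral_distr[OF haar_id_measurable[OF H]]) auto
  finally show ?thesis .
qed

text \<open>The witnesses are the norm of \<open>f\<close> and the p-th power of its absolute value
  divided by the integral of that power.\<close>

lemma normalized_power:
  fixes f :: "real ^ 'n::finite \<Rightarrow> complex"
  assumes fm [measurable]: "f \<in> borel_measurable borel" and p: "0 < p"
    and I0: "(\<integral>\<^sup>+t. ennreal (norm (f t) powr p) \<partial>lborel) \<noteq> 0"
    and fin: "Lp_norm p f \<noteq> \<infinity>"
  obtains N F where "N > 0" and "Lp_norm p f = ennreal N" and "unit_mass F"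
    and "\<And>t. ennreal (norm (f t)) = ennreal N * pw F (1 / p) t"
proof -
  obtain i where i: "(\<integral>\<^sup>+t. ennreal (norm (f t) powr p) \<partial>lborel) = ennreal i" "i \<ge> 0"
    using fin by (cases "\<integral>\<^sup>+t. ennreal (norm (f t) powr p) \<partial>lborel") (auto simp: Lp_norm_def)
  have i0: "i > 0" using i I0 by (cases "i = 0") auto
  define N where "N = i powr (1 / p)"
  define F where "F t = norm (f t) powr p / i" for t
  have "N > 0" using i0 by (simp add: N_def)
  moreover have "Lp_norm p f = ennreal N" using i by (simp add: Lp_norm_def N_def)
  moreover have "unit_mass F"
  proof -
    have "(\<integral>\<^sup>+t. ennreal (F t) \<partial>lborel) = (\<integral>\<^sup>+t. ennreal (1 / i) * ennreal (norm (f t) powr p) \<partial>lborel)"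
      using i0 by (intro nn_integral_cong) (simp add: F_def ennreal_mult[symmetric])
    also have "\<dots> = ennreal (1 / i) * ennreal i"
      by (subst nn_integral_cmult) (auto simp: i(1))
    also have "\<dots> = 1" using i0 by (simp add: ennreal_mult[symmetric])
    finally show ?thesis using i0 unfolding unit_mass_def F_def by simp
  qed
  moreover have "ennreal (norm (f t)) = ennreal N * pw F (1 / p) t" for t
  proof -
    have "norm (f t) = (norm (f t) powr p) powr (1 / p)" using p by (simp add: powr_powr)
    also have "norm (f t) powr p = i * F t" using i0 by (simp add: F_def)
    also have "(i * F t) powr (1 / p) = N * F t powr (1 / p)"
      unfolding N_def by (rule powr_mult)
    finally show ?thesis by (simp add: pw_def ennreal_mult N_def)
  qed
  ultimately show ?thesis by (rule that)
qed

theorem theorem1: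
  fixes H :: "(real ^ 'n ^ 'n::finite) measure"
    and b :: "nat \<Rightarrow> 'n"
    and p q s r :: real
  assumes "CARD('n) > 15"
    and "haar_prob_SO H"
    and "bij_betw b {1..CARD('n)} (UNIV :: 'n set)"
    and "(1 / p, 1 / q, 1 / s) \<in> Conv (boundedness_vertices (real CARD('n)))"
    and "1 / r = 1 / p + 1 / q + 1 / s"
  shows "\<exists>C::real. C > 0 \<and>
    (\<forall>f\<in>schwartz. \<forall>g\<in>schwartz. \<forall>h\<in>schwartz.
       Lp_norm r (pyramid_op H b f g h) \<le>
         ennreal C * Lp_norm p f * Lp_norm q g * Lp_norm s h)"
proof -
  have n: "3 \<le> CARD('n)" using assms(1) by simp
  interpret rotation_average "distr H borel (\<lambda>R. R)" by (rule rotation_average_haar[OF assms(2) n])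
  have inj: "inj_on b {1, 2, 3}"
    using assms(1) by (intro inj_on_subset[OF bij_betw_imp_inj_on[OF assms(3)]]) auto
  have pos: "0 < p" "0 < q" "0 < s" and \<sigma>: "1 \<le> 1 / p + 1 / q + 1 / s"
    using Conv_boundedness_vertices[OF _ assms(4)] assms(1) by auto
  have r0: "0 < r" using \<sigma> assms(5) zero_less_divide_1_iff[of r] by linarith
  have rr: "1 / (1 / p + 1 / q + 1 / s) = r" by (simp add: assms(5)[symmetric])
  define u v w :: "real ^ 'n" where uvw: "u = axis (b 1) 1" "v = (1 / 2) *\<^sub>R axis (b 1) 1 + (sqrt 3 / 2) *\<^sub>R axis (b 2) 1"
    "w = (1 / 2) *\<^sub>R axis (b 1) 1 + (1 / (2 * sqrt 3)) *\<^sub>R axis (b 2) 1 + (sqrt 2 / sqrt 3) *\<^sub>R axis (b 3) (1 :: real)"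
  \<comment> \<open>Applied to the identity rotation, \<open>rotated_pyramid_in_pyramid_set\<close>
    gives all six edge lengths.\<close>
  have "rotated_pyramid b (mat 1) = (u, v, w)"
    by (simp add: rotated_pyramid_def uvw Let_def)
  moreover have "rotated_pyramid b (mat 1) \<in> pyramid_set"
    by (rule rotated_pyramid_in_pyramid_set[OF inj]) (simp add: SO_def rotation_matrix_def orthogonal_matrix_id)
  ultimately have nu: "norm u = 1" "norm v = 1" "norm w = 1"
    and d: "norm (u - v) = 1" "norm (v - w) = 1" "norm (w - u) = 1"
    by (simp_all add: pyramid_set_def)
  define a where "a = (3 * real CARD('n) - 2) / (5 * real CARD('n))"
  have a: "1/2 \<le> a" "a \<le> 5/8" using assms(1) by (simp_all add: a_def field_simps)
  have "(1 / p, 1 / q, 1 / s) \<in> convex hull boundedness_vertices (real CARD('n))"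
    using assms(4) interior_subset by (auto simp: Conv_def)
  then have "L1_bounded u v w (1 / p, 1 / q, 1 / s)"
    using convex_hull_vertices_subset[OF d a] unfolding boundedness_vertices_eq[OF a_def] by blast
  from epow_tri_avg_bounded[OF nu \<sigma> this] obtain C0 :: real where C0: "C0 \<ge> 0"
    and T: "\<And>F G H'. \<lbrakk>unit_mass F; unit_mass G; unit_mass H'\<rbrakk> \<Longrightarrow>
      (\<integral>\<^sup>+t. epow (tri_avg u v w (pw F (1 / p)) (pw G (1 / q)) (pw H' (1 / s)) t) r \<partial>lborel) \<le> ennreal C0"
    unfolding rr by blast
  \<comment> \<open>The root undoes the power \<open>r\<close> in the integral; the maximum keeps
    \<open>C\<close> positive even if \<open>C0 = 0\<close>.\<close>
  define C where "C = max C0 1 powr (1 / r)"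
  have "C > 0" by (simp add: C_def)
  moreover have "Lp_norm r (pyramid_op H b f g h) \<le> ennreal C * Lp_norm p f * Lp_norm q g * Lp_norm s h"
    if fgh: "f \<in> schwartz" "g \<in> schwartz" "h \<in> schwartz" for f g h
  proof -
    note cont = fgh[THEN schwartz_continuous]
    note m = cont[THEN borel_measurable_continuous_onI]
    let ?I = "\<lambda>p f. \<integral>\<^sup>+t. ennreal (norm (f t) powr p) \<partial>(lborel :: (real ^ 'n) measure)"
    \<comment> \<open>In \<open>ennreal\<close> the product of 0 and infinity is 0. So a vanishing
      norm is treated first, where the operator itself is 0; after that an infinite norm makes the
      right side infinite. Normalisation is left for norms that are positive and finite.\<close>
    consider "?I p f = 0 \<or> ?I q g = 0 \<or> ?I s h = 0"
      | "?I p f \<noteq> 0" "?I q g \<noteq> 0" "?I s h \<noteq> 0" "Lp_norm p f = \<infinity> \<or> Lp_norm q g = \<infinity> \<or> Lp_norm s h = \<infinity>"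
      | "?I p f \<noteq> 0" "?I q g \<noteq> 0" "?I s h \<noteq> 0" "Lp_norm p f \<noteq> \<infinity>" "Lp_norm q g \<noteq> \<infinity>" "Lp_norm s h \<noteq> \<infinity>"
      by blast
    then show ?thesis
    proof cases
      case 1
      then have "(\<forall>t. f t = 0) \<or> (\<forall>t. g t = 0) \<or> (\<forall>t. h t = 0)"
        using cont[THEN continuous_nn_integral_powr_eq_0] by blast
      then have "f (t - x) * g (t - y) * h (t - z) = 0" for t x y z by auto
      then have "(\<lambda>(u, v, w). f (t - u) * g (t - v) * h (t - w)) = (\<lambda>_. 0)" for t
        by (simp only: case_prod_unfold)
      then have "pyramid_op H b f g h t = 0" for t by (simp add: pyramid_op_def)
      then show ?thesis by (simp add: Lp_norm_def)
    next
      case 2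
      have "Lp_norm p' f' \<noteq> 0" if "?I p' f' \<noteq> 0" for p' f'
        using that by (cases "?I p' f'") (auto simp: Lp_norm_def)
      then have "ennreal C * Lp_norm p f * Lp_norm q g * Lp_norm s h = \<infinity>"
        using 2 \<open>C > 0\<close> by (auto simp: ennreal_mult_eq_top_iff)
      then show ?thesis by simp
    next
      case 3
      obtain Nf F where F: "Nf > 0" "Lp_norm p f = ennreal Nf" "unit_mass F" "\<And>t. ennreal (norm (f t)) = ennreal Nf * pw F (1 / p) t"
        using normalized_power[OF m(1) pos(1) 3(1,4)] by blast
      obtain Ng G where G: "Ng > 0" "Lp_norm q g = ennreal Ng" "unit_mass G" "\<And>t. ennreal (norm (g t)) = ennreal Ng * pw G (1 / q) t"
        using normalized_power[OF m(2) pos(2) 3(2,5)] by blast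
      obtain Nh H' where H': "Nh > 0" "Lp_norm s h = ennreal Nh" "unit_mass H'" "\<And>t. ennreal (norm (h t)) = ennreal Nh * pw H' (1 / s) t"
        using normalized_power[OF m(3) pos(3) 3(3,6)] by blast
      note [measurable] = unit_massD(1)[OF F(3)] unit_massD(1)[OF G(3)] unit_massD(1)[OF H'(3)]
      define N where "N = Nf * Ng * Nh"
      have N: "N > 0" using F(1) G(1) H'(1) by (simp add: N_def)
      define T where "T = tri_avg u v w (pw F (1 / p)) (pw G (1 / q)) (pw H' (1 / s))"
      have Tm[measurable]: "T \<in> borel_measurable borel" unfolding T_def by measurable
      have NN: "ennreal N = ennreal Nf * ennreal Ng * ennreal Nh"
        using F(1) G(1) H'(1) by (simp add: N_def ennreal_mult)
      have le: "ennreal (norm (pyramid_op H b f g h t)) \<le> ennreal N * T t" for t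
      proof -
        have ac: "(a1 * b1) * (a2 * b2) * (a3 * b3) = (a1 * a2 * a3) * (b1 * b2 * b3)" for a1 a2 a3 b1 b2 b3 :: ennreal
          by (simp add: mult_ac)
        have "ennreal (norm (pyramid_op H b f g h t)) \<le> tri_avg u v w
            (\<lambda>t. ennreal (norm (f t))) (\<lambda>t. ennreal (norm (g t))) (\<lambda>t. ennreal (norm (h t))) t"
          by (rule pyramid_op_le_tri_avg[OF inj assms(2) n m uvw])
        also have "\<dots> = ennreal N * T t"
          unfolding T_def tri_avg_def F(4) G(4) H'(4) ac NN[symmetric] by (rule nn_integral_cmult) measurable
        finally show ?thesis .
      qed
      have pointwise: "ennreal (norm (pyramid_op H b f g h t) powr r) \<le> ennreal (N powr r) * epow (T t) r" for t
      proof (cases "T t")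
        case (real \<tau>)
        have "ennreal (norm (pyramid_op H b f g h t)) \<le> ennreal (N * \<tau>)"
          using le[of t] real N by (simp add: ennreal_mult)
        then have "norm (pyramid_op H b f g h t) \<le> N * \<tau>" using real N by (simp add: ennreal_le_iff)
        then have "norm (pyramid_op H b f g h t) powr r \<le> (N * \<tau>) powr r"
          using r0 by (intro powr_mono2) auto
        also have "\<dots> = N powr r * \<tau> powr r" using N real by (simp add: powr_mult)
        finally have "ennreal (norm (pyramid_op H b f g h t) powr r) \<le> ennreal (N powr r * \<tau> powr r)" by (rule ennreal_leI)
        then show ?thesis using real by (simp add: epow_def ennreal_mult)
      next
        case top
        have "ennreal (N powr r) \<noteq> 0" using N by (simp add: powr_gt_zero not_le)
        then show ?thesis by (simp add: top epow_def ennreal_mult_top)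
      qed
      have "?I r (pyramid_op H b f g h) \<le> (\<integral>\<^sup>+t. ennreal (N powr r) * epow (T t) r \<partial>lborel)"
        by (intro nn_integral_mono pointwise)
      also have "\<dots> = ennreal (N powr r) * (\<integral>\<^sup>+t. epow (T t) r \<partial>lborel)"
        by (rule nn_integral_cmult) measurable
      also have "\<dots> \<le> ennreal (N powr r) * ennreal (max C0 1)"
        unfolding T_def by (intro mult_left_mono order_trans[OF T[OF F(3) G(3) H'(3)]] ennreal_leI) simp_all
      also have "\<dots> = ennreal (N powr r * max C0 1)" by (intro ennreal_mult[symmetric]) auto
      finally have I: "?I r (pyramid_op H b f g h) \<le> ennreal (N powr r * max C0 1)" .
      then obtain J where J: "?I r (pyramid_op H b f g h) = ennreal J" "J \<ge> 0"
        by (cases "?I r (pyramid_op H b f g h)") (auto simp: top_unique)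
      have "0 \<le> N powr r * max C0 1" by simp
      then have "J \<le> N powr r * max C0 1" using I J by (simp only: ennreal_le_iff)
      then have "J powr (1 / r) \<le> (N powr r * max C0 1) powr (1 / r)"
        using J r0 by (intro powr_mono2) auto
      also have "\<dots> = (N powr r) powr (1 / r) * C" unfolding C_def by (rule powr_mult)
      also have "(N powr r) powr (1 / r) = N" using N r0 by (simp add: powr_powr)
      finally have "Lp_norm r (pyramid_op H b f g h) \<le> ennreal (N * C)"
        unfolding Lp_norm_def Let_def J(1) using J(2) by (simp add: ennreal_leI)
      also have "ennreal (N * C) = ennreal C * ennreal N"
        using N \<open>C > 0\<close> by (simp add: ennreal_mult mult.commute)
      also have "\<dots> = ennreal C * Lp_norm p f * Lp_norm q g * Lp_norm s h"
        unfolding NN F(2) G(2) H'(2) by (simp only: mult.assoc)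
      finally show ?thesis .
    qed
  qed
  ultimately show ?thesis by blast
qed

end
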